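(* Let $X$ be a reflexive Banach space, let $T>0$, and let the following conditions be satisfied: 1. $\{\overleftarrow{U}_{t,s}\}_{0\le s\le t\le T}$ is a strongly continuous uniformly bounded forward evolution family in $\mathcal{L}(X)$; 2. $\overrightarrow{U}_{t,s}=(\overleftarrow{U}_{s,t})^*$, $0\le t\le s\le T$, is the adjoint backward evolution family (since $X$ is reflexive, it follows that this family is strongly continuous and uniformly bounded in $\mathcal{L}(X^* )$); 3. $C\in C_s([0,T];\mathcal{L}(X,X^* ))$ and $B\in C_s([0,T];\mathcal{L}(X^*,X))$; 4. $C(t)=C^*(t)\ge 0$ and $B(t)=B^*(t)\ge 0$ for all $t\in[0,T]$. Then for an arbitrary self-adjoint nonnegative operator $G\in\mathcal{L}(X,X^* )$ the Riccati integral equation $$P(t)=\overrightarrow{U}_{t,T}G\overleftarrow{U}_{T,t}+\int_t^T \overrightarrow{U}_{t,r}\{C(r)-P(r)B(r)P(r)\}\overleftarrow{U}_{r,t}\,dr,\qquad t\in[0,T],$$ has a unique solution $P\in C_s([0,T];\mathcal{L}(X,X^* ))$, and $P(t)=P^*(t)\ge 0$ for all $t\in[0,T]$.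
   Context: $\mathcal{L}(X_1,X_2)$ is the space of continuous linear operators between Banach spaces, $\mathcal{L}(Y)=\mathcal{L}(Y,Y)$. $C_s([0,T];\mathcal{L}(X_1,X_2))$ is the set of operator functions $P:[0,T]\to\mathcal{L}(X_1,X_2)$ such that $t\mapsto P(t)x$ is in $C([0,T];X_2)$ for each $x\in X_1$. Integrals of operator functions are understood in the strong sense (i.e. applied to each vector). A forward evolution family in $\mathcal{L}(Y)$ is a family $\{U_{t,s}\}_{0\le s\le t\le T}\subset\mathcal{L}(Y)$ with $U_{s,s}=I_Y$ and $U_{t,s}=U_{t,r}U_{r,s}$ for $0\le s\le r\le t\le T$. A backward evolution family in $\mathcal{L}(Y)$ is a family $\{V_{t,s}\}_{0\le t\le s\le T}\subset\mathcal{L}(Y)$ with $V_{s,s}=I_Y$ and $V_{t,s}=V_{t,r}V_{r,s}$ for $0\le t\le r\le s\le T$. Such a family is strongly continuous if it is strongly continuous in $t$ for each $s$ and strongly continuous in $s$ for each $t$ (separately); it is uniformly bounded if its operator norms are bounded by a common constant. Arrows $\overleftarrow{\ }$ and $\overrightarrow{\ }$ denote forward and backward families, respectively. $\langle y,x\rangle$ ($y\in X^*$, $x\in X$) is the duality pairing between $X^*$ and $X$; for complex scalars $X^*$ is the space of continuous conjugate-linear functionals, so the pairing is linear in $y$ and conjugate-linear in $x$ (for real scalars complex conjugation is trivial). For $U\in\mathcal{L}(X)$, $U^*\in\mathcal{L}(X^* )$ is given by $\langle U^*y,x\rangle=\langle y,Ux\rangle$. Identifying $X^{**}$ with $X$,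 the adjoint of $A_1\in\mathcal{L}(X,X^* )$ is $A_1^*\in\mathcal{L}(X,X^* )$ with $\langle A_1x_1,x_2\rangle=\overline{\langle A_1^*x_2,x_1\rangle}$ for all $x_1,x_2\in X$, and the adjoint of $A_2\in\mathcal{L}(X^*,X)$ is $A_2^*\in\mathcal{L}(X^*,X)$ with $\langle x_1,A_2x_2\rangle=\overline{\langle x_2,A_2^*x_1\rangle}$ for all $x_1,x_2\in X^*$. Such an operator is self-adjoint if it equals its adjoint. A self-adjoint $A_1\in\mathcal{L}(X,X^* )$ is nonnegative ($A_1\ge0$) if $\langle A_1x,x\rangle\ge0$ for all $x\in X$; a self-adjoint $A_2\in\mathcal{L}(X^*,X)$ is nonnegative ($A_2\ge 0$) if $\langle x,A_2x\rangle\ge0$ for all $x\in X^*$.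
   Formalization: Strong continuity of the adjoint backward family in condition 2 is assumed, not deduced from reflexivity: that deduction is false for general evolution families even in Hilbert space, and without it the equation can have no solution in C_s (e.g. B=C=0, G=I). *)

theory Defs
  imports "HOL-Analysis.Analysis"
begin

text \<open>
  The scalar field is real or complex. Both cases are treated at once by a class of normed fields
  with a conjugation; the real and the complex numbers are its instances. By the Gelfand-Mazur
  theorem they are the only ones up to isomorphism, and the axioms determine the conjugation, which
  is trivial over the reals.
\<close>

class real_or_complex = real_normed_field + banach +
  fixes conj :: "'a \<Rightarrow> 'a"
  assumes conj_add: "conj (x + y) = conj x + conj y"
    and conj_mult: "conj (x * y) = conj x * conj y"
    and conj_mult_self: "conj x * x = (norm x)\<^sup>2 *\<^sub>R 1"

instantiation real :: real_or_complex
begin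
definition conj_real :: "real \<Rightarrow> real" where "conj_real x = x"
instance by standard (simp_all add: conj_real_def power2_eq_square)
end

instantiation complex :: real_or_complex
begin
definition conj_complex :: "complex \<Rightarrow> complex" where "conj_complex = cnj"
instance
  by standard (simp_all add: conj_complex_def complex_norm_square scaleR_conv_of_real mult.commute del: of_real_power)
end

text \<open>
  A Banach space over the scalars \<open>'k\<close>: the additive group, the norm and completeness come from
  the type \<open>'a\<close>, and \<open>scl\<close> extends its real scalar multiplication to \<open>'k\<close>.
\<close>

locale banach_over = vector_space scl
  for scl :: "'k::real_or_complex \<Rightarrow> 'a::banach \<Rightarrow> 'a" +
  assumes norm_scl: "norm (scl c x) = norm c * norm x"
    and scl_of_real: "scl (of_real r) x = r *\<^sub>R x"

lemma banach_over_real: "banach_over ((*\<^sub>R) :: real \<Rightarrow> 'a::banach \<Rightarrow> 'a)"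
  by unfold_locales (simp_all add: algebra_simps)

lemma banach_over_self: "banach_over ((*) :: 'k \<Rightarrow> 'k \<Rightarrow> 'k::real_or_complex)"
  by unfold_locales (simp_all add: algebra_simps norm_mult scaleR_conv_of_real)

text \<open>
  The dual space of continuous conjugate-linear functionals, as a subspace of the space of
  continuous real-linear maps from \<open>'a\<close> to \<open>'k\<close>, from which it inherits its norm.
\<close>

definition dual :: "('k::real_or_complex \<Rightarrow> 'a::banach \<Rightarrow> 'a) \<Rightarrow> ('a \<Rightarrow>\<^sub>L 'k) set"
  where "dual scl = {y. \<forall>c x. blinfun_apply y (scl c x) = conj c * blinfun_apply y x}"

definition dual_scl :: "'k::real_or_complex \<Rightarrow> ('a::banach \<Rightarrow>\<^sub>L 'k) \<Rightarrow> ('a \<Rightarrow>\<^sub>L 'k)"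
  where "dual_scl c y = blinfun_mult_right c o\<^sub>L y"

abbreviation pairing :: "('a::banach \<Rightarrow>\<^sub>L 'k::real_or_complex) \<Rightarrow> 'a \<Rightarrow> 'k"  ("\<langle>_, _\<rangle>")
  where "\<langle>y, x\<rangle> \<equiv> blinfun_apply y x"

lemma dual_scl_pairing: "\<langle>dual_scl c y, x\<rangle> = c * \<langle>y, x\<rangle>"
  by (simp add: dual_scl_def)

lemma dual_real: "dual ((*\<^sub>R) :: real \<Rightarrow> 'a::banach \<Rightarrow> 'a) = UNIV"
  by (auto simp: dual_def conj_real_def blinfun.scaleR_right)

text \<open>
  Continuous linear operators between the subspaces \<open>S1\<close> and \<open>S2\<close>. An operator on the dual space is
  represented by a function whose values outside the dual space are irrelevant.
\<close>

definition operators ::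
  "('k \<Rightarrow> 'b \<Rightarrow> 'b) \<Rightarrow> 'b set \<Rightarrow> ('k \<Rightarrow> 'c \<Rightarrow> 'c) \<Rightarrow> 'c set
    \<Rightarrow> ('b::real_normed_vector \<Rightarrow> 'c::real_normed_vector) set"
  where "operators s1 S1 s2 S2 =
    {A. A ` S1 \<subseteq> S2 \<and>
        (\<forall>x\<in>S1. \<forall>y\<in>S1. A (x + y) = A x + A y) \<and>
        (\<forall>c. \<forall>x\<in>S1. A (s1 c x) = s2 c (A x)) \<and>
        continuous_on S1 A}"

abbreviation L_X_X :: "('k::real_or_complex \<Rightarrow> 'a::banach \<Rightarrow> 'a) \<Rightarrow> ('a \<Rightarrow> 'a) set"
  where "L_X_X scl \<equiv> operators scl UNIV scl UNIV"

abbreviation L_X_dual ::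
  "('k::real_or_complex \<Rightarrow> 'a::banach \<Rightarrow> 'a) \<Rightarrow> ('a \<Rightarrow> ('a \<Rightarrow>\<^sub>L 'k)) set"
  where "L_X_dual scl \<equiv> operators scl UNIV dual_scl (dual scl)"

abbreviation L_dual_X ::
  "('k::real_or_complex \<Rightarrow> 'a::banach \<Rightarrow> 'a) \<Rightarrow> (('a \<Rightarrow>\<^sub>L 'k) \<Rightarrow> 'a) set"
  where "L_dual_X scl \<equiv> operators dual_scl (dual scl) scl UNIV"

abbreviation L_dual_dual ::
  "('k::real_or_complex \<Rightarrow> 'a::banach \<Rightarrow> 'a) \<Rightarrow> (('a \<Rightarrow>\<^sub>L 'k) \<Rightarrow> ('a \<Rightarrow>\<^sub>L 'k)) set"
  where "L_dual_dual scl \<equiv> operators dual_scl (dual scl) dual_scl (dual scl)"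

text \<open>
  Reflexivity: every continuous conjugate-linear functional on the dual space is the evaluation
  \<open>y \<mapsto> conj \<langle>y, x\<rangle>\<close> at some vector \<open>x\<close>.
\<close>

definition reflexive_space :: "('k::real_or_complex \<Rightarrow> 'a::banach \<Rightarrow> 'a) \<Rightarrow> bool"
  where "reflexive_space scl \<longleftrightarrow>
    (\<forall>\<phi> :: ('a \<Rightarrow>\<^sub>L 'k) \<Rightarrow> 'k.
      (\<forall>y\<in>dual scl. \<forall>z\<in>dual scl. \<phi> (y + z) = \<phi> y + \<phi> z) \<and>
      (\<forall>c. \<forall>y\<in>dual scl. \<phi> (dual_scl c y) = conj c * \<phi> y) \<and>
      continuous_on (dual scl) \<phi>
      \<longrightarrow> (\<exists>x. \<forall>y\<in>dual scl. \<phi> y = conj \<langle>y, x\<rangle>))"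

text \<open>Adjoints of operators in \<open>L(X)\<close>, \<open>L(X, X*)\<close> and \<open>L(X*, X)\<close>.\<close>

definition is_adjoint_X_X ::
  "('k::real_or_complex \<Rightarrow> 'a::banach \<Rightarrow> 'a) \<Rightarrow> ('a \<Rightarrow> 'a) \<Rightarrow> (('a \<Rightarrow>\<^sub>L 'k) \<Rightarrow> ('a \<Rightarrow>\<^sub>L 'k)) \<Rightarrow> bool"
  where "is_adjoint_X_X scl U V \<longleftrightarrow>
    V \<in> L_dual_dual scl \<and> (\<forall>y\<in>dual scl. \<forall>x. \<langle>V y, x\<rangle> = \<langle>y, U x\<rangle>)"

definition is_adjoint_X_dual ::
  "('k::real_or_complex \<Rightarrow> 'a::banach \<Rightarrow> 'a) \<Rightarrow> ('a \<Rightarrow> ('a \<Rightarrow>\<^sub>L 'k)) \<Rightarrow> ('a \<Rightarrow> ('a \<Rightarrow>\<^sub>L 'k)) \<Rightarrow> bool"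
  where "is_adjoint_X_dual scl A A' \<longleftrightarrow>
    A' \<in> L_X_dual scl \<and> (\<forall>x1 x2. \<langle>A x1, x2\<rangle> = conj \<langle>A' x2, x1\<rangle>)"

definition is_adjoint_dual_X ::
  "('k::real_or_complex \<Rightarrow> 'a::banach \<Rightarrow> 'a) \<Rightarrow> (('a \<Rightarrow>\<^sub>L 'k) \<Rightarrow> 'a) \<Rightarrow> (('a \<Rightarrow>\<^sub>L 'k) \<Rightarrow> 'a) \<Rightarrow> bool"
  where "is_adjoint_dual_X scl A A' \<longleftrightarrow>
    A' \<in> L_dual_X scl \<and>
    (\<forall>y1\<in>dual scl. \<forall>y2\<in>dual scl. \<langle>y1, A y2\<rangle> = conj \<langle>y2, A' y1\<rangle>)"

definition selfadjoint_X_dual ::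
  "('k::real_or_complex \<Rightarrow> 'a::banach \<Rightarrow> 'a) \<Rightarrow> ('a \<Rightarrow> ('a \<Rightarrow>\<^sub>L 'k)) \<Rightarrow> bool"
  where "selfadjoint_X_dual scl A \<longleftrightarrow> is_adjoint_X_dual scl A A"

definition selfadjoint_dual_X ::
  "('k::real_or_complex \<Rightarrow> 'a::banach \<Rightarrow> 'a) \<Rightarrow> (('a \<Rightarrow>\<^sub>L 'k) \<Rightarrow> 'a) \<Rightarrow> bool"
  where "selfadjoint_dual_X scl A \<longleftrightarrow> is_adjoint_dual_X scl A A"

definition nonneg_X_dual :: "('a::banach \<Rightarrow> ('a \<Rightarrow>\<^sub>L 'k::real_or_complex)) \<Rightarrow> bool"
  where "nonneg_X_dual A \<longleftrightarrow> (\<forall>x. \<langle>A x, x\<rangle> \<in> \<real>\<^sub>\<ge>\<^sub>0)"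

definition nonneg_dual_X ::
  "('k::real_or_complex \<Rightarrow> 'a::banach \<Rightarrow> 'a) \<Rightarrow> (('a \<Rightarrow>\<^sub>L 'k) \<Rightarrow> 'a) \<Rightarrow> bool"
  where "nonneg_dual_X scl A \<longleftrightarrow> (\<forall>y\<in>dual scl. \<langle>y, A y\<rangle> \<in> \<real>\<^sub>\<ge>\<^sub>0)"

definition Cs_X_dual ::
  "('k::real_or_complex \<Rightarrow> 'a::banach \<Rightarrow> 'a) \<Rightarrow> real \<Rightarrow> (real \<Rightarrow> 'a \<Rightarrow> ('a \<Rightarrow>\<^sub>L 'k)) set"
  where "Cs_X_dual scl T =
    {P. (\<forall>t\<in>{0..T}. P t \<in> L_X_dual scl) \<and> (\<forall>x. continuous_on {0..T} (\<lambda>t. P t x))}"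

definition Cs_dual_X ::
  "('k::real_or_complex \<Rightarrow> 'a::banach \<Rightarrow> 'a) \<Rightarrow> real \<Rightarrow> (real \<Rightarrow> ('a \<Rightarrow>\<^sub>L 'k) \<Rightarrow> 'a) set"
  where "Cs_dual_X scl T =
    {P. (\<forall>t\<in>{0..T}. P t \<in> L_dual_X scl) \<and>
        (\<forall>y\<in>dual scl. continuous_on {0..T} (\<lambda>t. P t y))}"

text \<open>In the families below, \<open>U t s\<close> and \<open>V t s\<close> stand for the operators with index \<open>t,s\<close>.\<close>

definition forward_evolution_family ::
  "('k::real_or_complex \<Rightarrow> 'a::banach \<Rightarrow> 'a) \<Rightarrow> real \<Rightarrow> (real \<Rightarrow> real \<Rightarrow> 'a \<Rightarrow> 'a) \<Rightarrow> bool"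
  where "forward_evolution_family scl T U \<longleftrightarrow>
    (\<forall>s t. 0 \<le> s \<and> s \<le> t \<and> t \<le> T \<longrightarrow> U t s \<in> L_X_X scl) \<and>
    (\<forall>s\<in>{0..T}. U s s = id) \<and>
    (\<forall>s r t. 0 \<le> s \<and> s \<le> r \<and> r \<le> t \<and> t \<le> T \<longrightarrow> U t s = U t r \<circ> U r s)"

definition forward_strongly_continuous ::
  "real \<Rightarrow> (real \<Rightarrow> real \<Rightarrow> 'a::banach \<Rightarrow> 'a) \<Rightarrow> bool"
  where "forward_strongly_continuous T U \<longleftrightarrow>
    (\<forall>x. (\<forall>s\<in>{0..T}. continuous_on {s..T} (\<lambda>t. U t s x)) \<and>
         (\<forall>t\<in>{0..T}. continuous_on {0..t} (\<lambda>s. U t s x)))"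

definition forward_uniformly_bounded ::
  "real \<Rightarrow> (real \<Rightarrow> real \<Rightarrow> 'a::banach \<Rightarrow> 'a) \<Rightarrow> bool"
  where "forward_uniformly_bounded T U \<longleftrightarrow>
    (\<exists>M. \<forall>s t. 0 \<le> s \<and> s \<le> t \<and> t \<le> T \<longrightarrow> onorm (U t s) \<le> M)"

text \<open>
  Strong continuity of a backward family in the dual space. For adjoint families it does not follow
  from strong continuity of the forward family, not even in a Hilbert space. Let \<open>e\<close> be a unit vector
  and \<open>f\<close> a function that is weakly but not norm continuous, with values orthogonal to \<open>e\<close>. Then
  \<open>U t s x = x + \<langle>x, f t - f s\<rangle> e\<close> is a strongly continuous uniformly bounded forward family, with
  adjoint \<open>V t s y = y + \<langle>y, e\<rangle> (f s - f t)\<close>.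
\<close>

definition backward_strongly_continuous ::
  "('k::real_or_complex \<Rightarrow> 'a::banach \<Rightarrow> 'a) \<Rightarrow> real
    \<Rightarrow> (real \<Rightarrow> real \<Rightarrow> ('a \<Rightarrow>\<^sub>L 'k) \<Rightarrow> ('a \<Rightarrow>\<^sub>L 'k)) \<Rightarrow> bool"
  where "backward_strongly_continuous scl T V \<longleftrightarrow>
    (\<forall>y\<in>dual scl. (\<forall>s\<in>{0..T}. continuous_on {0..s} (\<lambda>t. V t s y)) \<and>
                  (\<forall>t\<in>{0..T}. continuous_on {t..T} (\<lambda>s. V t s y)))"

text \<open>
  The Riccati integral equation. The integral is the strong one, taken after applying the operators
  to a vector. The integrand is continuous in \<open>r\<close> under the assumptions of the theorem, so that
  demanding integrability is no restriction there.
\<close>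

definition riccati_solution ::
  "real \<Rightarrow> (real \<Rightarrow> real \<Rightarrow> 'a::banach \<Rightarrow> 'a)
    \<Rightarrow> (real \<Rightarrow> real \<Rightarrow> ('a \<Rightarrow>\<^sub>L 'k::real_or_complex) \<Rightarrow> ('a \<Rightarrow>\<^sub>L 'k))
    \<Rightarrow> (real \<Rightarrow> 'a \<Rightarrow> ('a \<Rightarrow>\<^sub>L 'k)) \<Rightarrow> (real \<Rightarrow> ('a \<Rightarrow>\<^sub>L 'k) \<Rightarrow> 'a)
    \<Rightarrow> ('a \<Rightarrow> ('a \<Rightarrow>\<^sub>L 'k)) \<Rightarrow> (real \<Rightarrow> 'a \<Rightarrow> ('a \<Rightarrow>\<^sub>L 'k)) \<Rightarrow> bool"
  where "riccati_solution T U V C B G P \<longleftrightarrow>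
    (\<forall>t\<in>{0..T}. \<forall>x.
      (\<lambda>r. V t r (C r (U r t x) - P r (B r (P r (U r t x))))) integrable_on {t..T} \<and>
      P t x = V t T (G (U T t x))
        + integral {t..T} (\<lambda>r. V t r (C r (U r t x) - P r (B r (P r (U r t x))))))"

end

theory Submission
  imports Defs
begin

text \<open>
  Local solutions, self-adjoint by construction, come from Picard iteration on intervals whose length
  depends only on a bound for the terminal operator. They extend to \<open>[0, T]\<close> by an a priori bound:
  once \<open>P \<ge> 0\<close>, dropping the term \<open>- P B P\<close> gives \<open>\<langle>P t x, x\<rangle> \<le> \<beta> \<parallel>x\<parallel>\<^sup>2\<close>, and polarization turns this
  into \<open>\<parallel>P t\<parallel> \<le> \<beta>\<close>, with \<open>\<beta>\<close> independent of the interval. For nonnegativity, let \<open>z\<close> solve the mild closed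
  loop equation \<open>z r = U r t x - \<integral> U r q (B q (P q (z q))) dq\<close>, the integral extending from \<open>t\<close> to \<open>r\<close>. The
  function \<open>r \<mapsto> \<langle>P r (z r), z r\<rangle>\<close> is continuous with nonpositive right derivative, so its value
  \<open>\<langle>P t x, x\<rangle>\<close> at \<open>t\<close> is at least its value \<open>\<langle>G (z T), z T\<rangle> \<ge> 0\<close> at \<open>T\<close>. Uniqueness is a Gronwall argument
  with an exponential weight.
\<close>

section \<open>Uniform boundedness, contractions and one-sided derivatives\<close>

text \<open>The evolution family is strongly continuous in each index separately and no generator is
  assumed. There is no differential Riccati equation, and integrals whose kernel moves with their
  end point cannot be treated by joint continuity. Instead, a fixed intermediate time
  \<open>s\<close> and the evolution law split such an integral into a fixed object transported by
  one strongly continuous operator and an integral over a short interval. The minus sign of the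
  quadratic term is the other obstacle: the equation itself does not show \<open>P \<ge> 0\<close>,
  yet the a priori bound needs it. Feedback turns the sign. To first order in time, the term
  \<open>- P B P\<close> contributes \<open>+ \<langle>P z, B P z\<rangle>\<close> to the growth of
  \<open>\<langle>P z, z\<rangle>\<close>, while the feedback \<open>- B P z\<close> contributes
  twice this amount with a minus sign. The dual space is a closed subset of a type, so operators on
  it are controlled only there, and identities between functionals are checked by pairing them with
  a vector.\<close>

lemma uniform_boundedness_on:
  fixes A :: "'i \<Rightarrow> 'b::banach \<Rightarrow> 'c::real_normed_vector"
  assumes S: "closed S" "subspace S"
    and add: "\<And>i x y. i \<in> I \<Longrightarrow> x \<in> S \<Longrightarrow> y \<in> S \<Longrightarrow> A i (x + y) = A i x + A i y"
    and scale: "\<And>i x r. i \<in> I \<Longrightarrow> x \<in> S \<Longrightarrow> A i (r *\<^sub>R x) = r *\<^sub>R A i x"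
    and cont: "\<And>i. i \<in> I \<Longrightarrow> continuous_on S (A i)"
    and bdd: "\<And>x. x \<in> S \<Longrightarrow> bounded ((\<lambda>i. A i x) ` I)"
  obtains K where "K > 0" "\<And>i x. i \<in> I \<Longrightarrow> x \<in> S \<Longrightarrow> norm (A i x) \<le> K * norm x"
proof -
  \<comment> \<open>Baire's theorem inside \<open>S\<close>, which is complete as a closed set: the
    relatively closed sets \<open>F n\<close> exhaust \<open>S\<close>, so one of them contains a
    relative ball. A subspace is allowed because the dual space is only a part of its type.\<close>
  define F where "F n = {x \<in> S. \<forall>i\<in>I. norm (A i x) \<le> real n}" for n :: nat
  have "0 \<in> S"
    using S(2) by (rule subspace_0)
  have Un: "\<Union>(range F) = S"
  proof
    show "S \<subseteq> \<Union>(range F)"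
    proof
      fix x assume "x \<in> S"
      then obtain c where c: "\<And>i. i \<in> I \<Longrightarrow> norm (A i x) \<le> c"
        using bdd[of x] unfolding bounded_iff by auto
      obtain n :: nat where "c \<le> real n"
        using real_arch_simple by blast
      with c \<open>x \<in> S\<close> have "x \<in> F n"
        unfolding F_def by force
      then show "x \<in> \<Union>(range F)" by blast
    qed
  qed (auto simp: F_def)
  have clos: "closedin (top_of_set S) (F n)" for n
  proof -
    have "F n = (if I = {} then S else (\<Inter>i\<in>I. S \<inter> A i -` cball 0 (real n)))"
      unfolding F_def by auto
    moreover have "closedin (top_of_set S) (S \<inter> A i -` cball 0 (real n))" if "i \<in> I" for i
      by (rule continuous_closedin_preimage[OF cont[OF that] closed_cball])
    ultimately show ?thesis
      using closedin_INT[of I "top_of_set S" "\<lambda>i. S \<inter> A i -` cball 0 (real n)"] by simp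
  qed
  have "\<exists>n. top_of_set S interior_of F n \<noteq> {}"
  proof (rule ccontr)
    assume "\<not> ?thesis"
    then have "top_of_set S interior_of \<Union>(range F) = {}"
      using clos S(1)
      by (intro Baire_category_alt)
        (auto intro: completely_metrizable_space_closedin completely_metrizable_space_euclidean)
    then show False
      using \<open>0 \<in> S\<close> unfolding Un by (metis empty_iff interior_of_topspace topspace_euclidean_subtopology)
  qed
  then obtain n x0 W where W: "openin (top_of_set S) W" "W \<subseteq> F n" "x0 \<in> W"
    unfolding interior_of_def by auto
  then obtain e where e: "e > 0" "ball x0 e \<inter> S \<subseteq> W"
    using openin_contains_ball[of S W] by blast
  \<comment> \<open>Both \<open>x0 + u\<close> and \<open>x0\<close> lie in \<open>F n\<close>;
    subtracting them moves the bound from the centre \<open>x0\<close> to the origin.\<close>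
  have small: "norm (A i u) \<le> 2 * real n" if "i \<in> I" "u \<in> S" "norm u < e" for i u
  proof -
    have "x0 \<in> S"
      using W by (auto simp: F_def)
    then have "x0 + u \<in> F n"
      using that e(2) W(2) S(2) by (auto intro!: subsetD[OF W(2)] subsetD[OF e(2)] simp: dist_norm subspace_add)
    moreover have "x0 \<in> F n"
      using W by auto
    ultimately have "norm (A i x0 + A i u) \<le> n" "norm (A i x0) \<le> n"
      using that add[of i x0 u] by (auto simp: F_def)
    then show ?thesis
      using norm_triangle_ineq4[of "A i x0 + A i u" "A i x0"] by simp
  qed
  show thesis
  proof
    \<comment> \<open>Rescaling \<open>x\<close> to norm \<open>e / 2\<close> turns the bound
      \<open>2 * real n\<close> into the factor \<open>4 * real n / e\<close>; the added 1 keeps the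
      constant positive when \<open>n\<close> is 0.\<close>
    show "4 * real n / e + 1 > 0"
      using e by (simp add: add_nonneg_pos)
    fix i x assume ix: "i \<in> I" "x \<in> S"
    show "norm (A i x) \<le> (4 * real n / e + 1) * norm x"
    proof (cases "x = 0")
      case True
      then show ?thesis using scale[of i x 0] ix by simp
    next
      case False
      define r where "r = e / (2 * norm x)"
      have "r > 0" using e False by (simp add: r_def)
      have "norm (A i (r *\<^sub>R x)) \<le> 2 * real n"
        using ix e(1) False S(2) \<open>r > 0\<close>
        by (intro small) (auto simp: subspace_scale r_def)
      then have "norm (A i x) \<le> 2 * real n / r"
        using \<open>r > 0\<close> scale[OF ix] by (simp add: field_simps)
      also have "\<dots> = 4 * real n / e * norm x"
        using e False by (simp add: r_def)
      finally show ?thesis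
        unfolding distrib_right using norm_ge_zero[of x] by linarith
    qed
  qed
qed

text \<open>Banach's fixed point theorem, with distance the least \<open>c\<close> such that
  \<open>norm (f i - g i) \<le> c * w i\<close> on \<open>I\<close>; the weight may vanish. If the
  indices are pairs of a time and a vector, and the weight is the norm of the vector, this is the
  operator norm uniformly in time. With an exponential weight, Volterra operators contract on
  intervals of any length.\<close>

lemma weighted_contraction_fixpoint:
  fixes F :: "('i \<Rightarrow> 'b::banach) \<Rightarrow> 'i \<Rightarrow> 'b"
  assumes f0: "f0 \<in> S" and FS: "\<And>f. f \<in> S \<Longrightarrow> F f \<in> S"
    and w: "\<And>i. i \<in> I \<Longrightarrow> w i \<ge> 0" and d: "d > 0"
    and init: "\<And>i. i \<in> I \<Longrightarrow> norm (F f0 i - f0 i) \<le> d * w i"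
    and contr: "\<And>f g c i. f \<in> S \<Longrightarrow> g \<in> S \<Longrightarrow> c > 0 \<Longrightarrow>
      (\<And>j. j \<in> I \<Longrightarrow> norm (f j - g j) \<le> c * w j) \<Longrightarrow> i \<in> I \<Longrightarrow>
      norm (F f i - F g i) \<le> c / 2 * w i"
    and closed: "\<And>f (s :: nat \<Rightarrow> _). (\<And>n. s n \<in> S) \<Longrightarrow>
      (\<And>e. e > 0 \<Longrightarrow> \<exists>N. \<forall>n\<ge>N. \<forall>i\<in>I. norm (s n i - f i) \<le> e * w i) \<Longrightarrow> f \<in> S"
  obtains f where "f \<in> S" "\<And>i. i \<in> I \<Longrightarrow> F f i = f i"
proof -
  define s where "s n = (F ^^ n) f0" for n :: nat
  define q :: "nat \<Rightarrow> real" where "q n = d / 2 ^ n" for n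
  have q_pos: "q n > 0" for n
    using d by (simp add: q_def)
  have q_lim: "q \<longlonglongrightarrow> 0"
    unfolding q_def by real_asymp
  have q_small: "\<exists>N. \<forall>n\<ge>N. 2 * q n \<le> e" if "e > 0" for e
    using order_tendstoD(2)[OF q_lim, of "e/2"] that unfolding eventually_sequentially
    by (metis half_gt_zero_iff less_imp_le mult.commute pos_less_divide_eq zero_less_numeral)
  have sS: "s n \<in> S" for n
    by (induction n) (auto simp: s_def f0 FS)
  have step: "i \<in> I \<Longrightarrow> norm (s (Suc n) i - s n i) \<le> q n * w i" for n i
  proof (induction n arbitrary: i)
    case 0
    then show ?case using init by (simp add: s_def q_def)
  next
    case (Suc n)
    have "norm (F (s (Suc n)) i - F (s n) i) \<le> q n / 2 * w i"
      by (rule contr) (use Suc sS q_pos in auto)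
    then show ?case by (simp add: s_def q_def)
  qed
  have tail: "norm (s (n + k) i - s n i) \<le> 2 * q n * w i" if "i \<in> I" for n k i
  proof -
    \<comment> \<open>Telescoping: \<open>q j = 2 * q j - 2 * q (Suc j)\<close>, so the bracket is
      the sum of the step bounds from \<open>q n\<close> to \<open>q (n + k - 1)\<close>.\<close>
    have "norm (s (n + k) i - s n i) \<le> (2 * q n - 2 * q (n + k)) * w i"
    proof (induction k)
      case (Suc k)
      have "norm (s (n + Suc k) i - s n i)
        \<le> norm (s (Suc (n + k)) i - s (n + k) i) + norm (s (n + k) i - s n i)"
        using norm_triangle_ineq[of "s (Suc (n + k)) i - s (n + k) i" "s (n + k) i - s n i"] by simp
      also have "\<dots> \<le> q (n + k) * w i + (2 * q n - 2 * q (n + k)) * w i"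
        using step[OF that] Suc by (intro add_mono)
      also have "\<dots> = (2 * q n - 2 * q (n + Suc k)) * w i"
        by (simp add: q_def field_simps)
      finally show ?case .
    qed simp
    also have "\<dots> \<le> 2 * q n * w i"
      using w[OF that] q_pos[of "n+k"] by (intro mult_right_mono) auto
    finally show ?thesis .
  qed
  have Cau: "Cauchy (\<lambda>n. s n i)" if "i \<in> I" for i
  proof (rule metric_CauchyI)
    fix e :: real assume "e > 0"
    then obtain N where N: "2 * q N \<le> e / 4 / (w i + 1)"
      using q_small[of "e / 4 / (w i + 1)"] w[OF \<open>i \<in> I\<close>] by auto
    have "2 * q N * w i \<le> e / 4 / (w i + 1) * (w i + 1)"
      using N w[OF that] q_pos[of N] by (intro mult_mono) auto
    also have "\<dots> = e / 4" using w[OF that] by (simp add: divide_simps add_nonneg_eq_0_iff)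
    finally have *: "norm (s n i - s N i) \<le> e / 4" if "n \<ge> N" for n
      using tail[OF \<open>i \<in> I\<close>, of N "n - N"] that by simp
    show "\<exists>M. \<forall>m\<ge>M. \<forall>n\<ge>M. dist (s m i) (s n i) < e"
    proof (intro exI allI impI)
      fix m n assume "m \<ge> N" "n \<ge> N"
      have "dist (s m i) (s n i) \<le> dist (s m i) (s N i) + dist (s n i) (s N i)"
        by (rule dist_triangle2)
      then show "dist (s m i) (s n i) < e"
        using *[OF \<open>m \<ge> N\<close>] *[OF \<open>n \<ge> N\<close>] \<open>e > 0\<close> by (simp add: dist_norm)
    qed
  qed
  define f where "f i = lim (\<lambda>n. s n i)" for i
  have lim: "(\<lambda>n. s n i) \<longlonglongrightarrow> f i" if "i \<in> I" for i
    using Cau[OF that] unfolding f_def by (simp add: Cauchy_convergent convergent_LIMSEQ_iff[symmetric])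
  have dist_f: "norm (s n i - f i) \<le> 2 * q n * w i" if "i \<in> I" for n i
  proof -
    have "(\<lambda>k. norm (s (k + n) i - s n i)) \<longlonglongrightarrow> norm (f i - s n i)"
      by (intro tendsto_intros LIMSEQ_ignore_initial_segment lim that)
    then have "norm (f i - s n i) \<le> 2 * q n * w i"
      by (rule LIMSEQ_le_const2) (use tail[OF that, of n] in \<open>simp add: add.commute[of _ n]\<close>)
    then show ?thesis by (simp add: norm_minus_commute)
  qed
  have fS: "f \<in> S"
  proof (rule closed[of s f])
    show "s n \<in> S" for n by (rule sS)
    fix e :: real assume "e > 0"
    then obtain N where "\<forall>n\<ge>N. 2 * q n \<le> e" using q_small by blast
    then have "\<forall>n\<ge>N. \<forall>i\<in>I. norm (s n i - f i) \<le> e * w i"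
      by (auto intro!: order_trans[OF dist_f] mult_right_mono w)
    then show "\<exists>N. \<forall>n\<ge>N. \<forall>i\<in>I. norm (s n i - f i) \<le> e * w i"
      by blast
  qed
  show thesis
  proof
    show "f \<in> S" by fact
    fix i assume i: "i \<in> I"
    have "norm (s (Suc n) i - F f i) \<le> q n * w i" for n
    proof -
      have "norm (F (s n) i - F f i) \<le> (2 * q n) / 2 * w i"
      proof (rule contr[OF sS fS])
        show "2 * q n > 0" using q_pos[of n] by simp
      qed (fact dist_f, fact i)
      then show ?thesis by (simp add: s_def)
    qed
    then have "\<forall>\<^sub>F n in sequentially. norm (s (Suc n) i - F f i) \<le> q n * w i"
      by (intro always_eventually allI)
    moreover have "(\<lambda>n. q n * w i) \<longlonglongrightarrow> 0"
      using tendsto_mult[OF q_lim tendsto_const[of "w i"]] by simp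
    ultimately have "(\<lambda>n. s (Suc n) i - F f i) \<longlonglongrightarrow> 0"
      by (rule Lim_null_comparison)
    then have "(\<lambda>n. s (Suc n) i) \<longlonglongrightarrow> F f i"
      by (rule LIM_zero_cancel)
    then show "F f i = f i"
      using LIMSEQ_Suc[OF lim[OF i]] by (rule LIMSEQ_unique)
  qed
qed

lemma continuous_on_strong_apply:
  fixes A :: "'i::topological_space \<Rightarrow> 'b::real_normed_vector \<Rightarrow> 'c::real_normed_vector"
  assumes f: "continuous_on I f" and fD: "\<And>r. r \<in> I \<Longrightarrow> f r \<in> D"
    and A: "\<And>y. y \<in> D \<Longrightarrow> continuous_on I (\<lambda>r. A r y)"
    and lip: "\<And>r y z. r \<in> I \<Longrightarrow> y \<in> D \<Longrightarrow> z \<in> D \<Longrightarrow> norm (A r y - A r z) \<le> M * norm (y - z)"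
  shows "continuous_on I (\<lambda>r. A r (f r))"
  unfolding continuous_on_def
proof
  fix r0 assume r0: "r0 \<in> I"
  have "((\<lambda>r. A r (f r) - A r (f r0)) \<longlongrightarrow> 0) (at r0 within I)"
  proof (rule Lim_null_comparison)
    show "\<forall>\<^sub>F r in at r0 within I. norm (A r (f r) - A r (f r0)) \<le> M * norm (f r - f r0)"
      unfolding eventually_at_filter using lip fD r0 by (intro always_eventually) auto
    have "(f \<longlongrightarrow> f r0) (at r0 within I)"
      using f r0 by (simp add: continuous_on_def)
    then have "((\<lambda>r. M * norm (f r - f r0)) \<longlongrightarrow> M * norm (f r0 - f r0)) (at r0 within I)"
      by (intro tendsto_intros)
    then show "((\<lambda>r. M * norm (f r - f r0)) \<longlongrightarrow> 0) (at r0 within I)" by simp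
  qed
  moreover have "((\<lambda>r. A r (f r0)) \<longlongrightarrow> A r0 (f r0)) (at r0 within I)"
    using A[OF fD[OF r0]] r0 by (simp add: continuous_on_def)
  ultimately show "((\<lambda>r. A r (f r)) \<longlongrightarrow> A r0 (f r0)) (at r0 within I)"
    by (rule Lim_transform[rotated])
qed

text \<open>A uniform limit theorem in which the neighbourhood and the continuous approximant may
  depend on the point and on the tolerance. The approximant can thus be built from an intermediate
  time chosen for that point.\<close>

lemma continuous_on_locally_approximable:
  fixes f :: "'i::metric_space \<Rightarrow> 'b::real_normed_vector"
  assumes "\<And>t0 e. t0 \<in> I \<Longrightarrow> e > 0 \<Longrightarrow> \<exists>\<delta>>0. \<exists>g. continuous_on (I \<inter> ball t0 \<delta>) g \<and>
      (\<forall>t\<in>I \<inter> ball t0 \<delta>. norm (f t - g t) \<le> e)"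
  shows "continuous_on I f"
  unfolding continuous_on_iff
proof (intro ballI allI impI)
  fix t0 and e :: real assume t0: "t0 \<in> I" and "e > 0"
  then obtain \<delta> g where \<delta>: "\<delta> > 0" and g: "continuous_on (I \<inter> ball t0 \<delta>) g"
    and fg: "\<And>t. t \<in> I \<inter> ball t0 \<delta> \<Longrightarrow> norm (f t - g t) \<le> e / 4"
    using assms[of t0 "e/4"] by auto
  have t0': "t0 \<in> I \<inter> ball t0 \<delta>"
    using t0 \<delta> by simp
  then obtain \<eta> where \<eta>: "\<eta> > 0"
    and g': "\<And>t. t \<in> I \<inter> ball t0 \<delta> \<Longrightarrow> dist t t0 < \<eta> \<Longrightarrow> dist (g t) (g t0) < e / 4"
    using g \<open>e > 0\<close> unfolding continuous_on_iff by (metis divide_pos_pos zero_less_numeral)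
  show "\<exists>\<delta>>0. \<forall>t\<in>I. dist t t0 < \<delta> \<longrightarrow> dist (f t) (f t0) < e"
  proof (intro exI conjI ballI impI)
    show "min \<delta> \<eta> > 0" using \<delta> \<eta> by simp
    fix t assume "t \<in> I" "dist t t0 < min \<delta> \<eta>"
    then have t: "t \<in> I \<inter> ball t0 \<delta>" "dist t t0 < \<eta>"
      by (auto simp: dist_commute)
    have "dist (f t) (f t0) \<le> dist (f t) (g t) + dist (g t) (g t0) + dist (f t0) (g t0)"
      using dist_triangle[of "f t" "f t0" "g t"] dist_triangle2[of "g t" "f t0" "g t0"] by simp
    then show "dist (f t) (f t0) < e"
      using fg[OF t(1)] fg[OF t0'] g'[OF t] \<open>e > 0\<close> by (simp add: dist_norm)
  qed
qed

text \<open>After tilting \<open>f\<close> by a small slope, the set where it stays below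
  \<open>f a\<close> is closed by continuity, and the Dini condition pushes its supremum further to
  the right unless that is \<open>b\<close>.\<close>

lemma nonincreasing_if_right_Dini:
  fixes f :: "real \<Rightarrow> real"
  assumes "a \<le> b" and cont: "continuous_on {a..b} f"
    and Dini: "\<And>r e. a \<le> r \<Longrightarrow> r < b \<Longrightarrow> e > 0 \<Longrightarrow>
      eventually (\<lambda>s. f s - f r \<le> e * (s - r)) (at_right r)"
  shows "f b \<le> f a"
proof (rule field_le_epsilon)
  fix e0 :: real assume "e0 > 0"
  \<comment> \<open>The total tilt \<open>e * (b - a)\<close> is at most \<open>e0\<close>, and the
    divisor is positive even for \<open>a = b\<close>.\<close>
  define e where "e = e0 / (b - a + 1)"
  have "e > 0" using \<open>e0 > 0\<close> \<open>a \<le> b\<close> by (simp add: e_def)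
  define g where "g s = f s - e * (s - a)" for s
  define W where "W = {s \<in> {a..b}. g s \<le> f a}"
  have g_cont: "continuous_on {a..b} g"
    unfolding g_def by (intro continuous_intros cont)
  have "W = {a..b} \<inter> g -` {..f a}"
    by (auto simp: W_def)
  then have "closed W"
    using continuous_closed_preimage[OF g_cont closed_atLeastAtMost closed_atMost] by simp
  moreover have "a \<in> W" "bdd_above W"
    using \<open>a \<le> b\<close> by (auto simp: W_def g_def intro: bdd_aboveI)
  ultimately have c: "Sup W \<in> W"
    using closed_contains_Sup[of W] by blast
  have "Sup W = b"
  proof (rule ccontr)
    assume "Sup W \<noteq> b"
    then have "a \<le> Sup W" "Sup W < b" using c by (auto simp: W_def)
    have "eventually (\<lambda>s. s \<in> {Sup W<..<b}) (at_right (Sup W))"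
      using \<open>Sup W < b\<close> by (rule eventually_at_right_real)
    from eventually_happens'[OF _ eventually_conj[OF this Dini[OF \<open>a \<le> Sup W\<close> \<open>Sup W < b\<close> \<open>e > 0\<close>]]]
    obtain s where s: "f s - f (Sup W) \<le> e * (s - Sup W)" "Sup W < s" "s < b"
      by (auto simp: trivial_limit_at_right_real)
    moreover have "g s \<le> g (Sup W)"
      using s(1) by (simp add: g_def algebra_simps)
    ultimately have "s \<in> W"
      using c by (auto simp: W_def)
    then show False
      using cSup_upper[OF \<open>s \<in> W\<close> \<open>bdd_above W\<close>] s(2) by simp
  qed
  then have "f b \<le> f a + e * (b - a)"
    using c by (simp add: W_def g_def)
  also have "e * (b - a) \<le> e * (b - a + 1)"
    using \<open>e > 0\<close> by simp
  also have "\<dots> = e0"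
    using \<open>a \<le> b\<close> by (simp add: e_def)
  finally show "f b \<le> f a + e0" by simp
qed

section \<open>Scalars, dual space and quadratic forms\<close>

lemma conj_zero: "conj (0::'k::real_or_complex) = 0"
  using conj_add[of "0::'k" 0] by simp

lemma conj_one: "conj (1::'k::real_or_complex) = 1"
  using conj_mult_self[of "1::'k"] by simp

lemma conj_of_real: "conj (of_real r :: 'k::real_or_complex) = of_real r"
proof (cases "r = 0")
  case False
  have "conj (of_real r :: 'k) * of_real r = of_real r * of_real r"
    using conj_mult_self[of "of_real r :: 'k"] by (simp add: power2_eq_square scaleR_conv_of_real)
  then show ?thesis using False by simp
qed (simp add: conj_zero)

lemma norm_conj: "norm (conj (x::'k::real_or_complex)) = norm x"
proof (cases "x = 0")
  case False
  have "norm (conj x) * norm x = norm x * norm x"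
    using arg_cong[OF conj_mult_self[of x], of norm] by (simp add: norm_mult power2_eq_square)
  then show ?thesis using False by simp
qed (simp add: conj_zero)

text \<open>Both \<open>conj (conj x) * conj x\<close> and \<open>conj x * x\<close> are the squared
  norm of \<open>x\<close>; \<open>conj x\<close> cancels.\<close>

lemma conj_conj: "conj (conj (x::'k::real_or_complex)) = x"
proof (cases "x = 0")
  case False
  then have "conj x \<noteq> 0"
    using norm_conj[of x] by auto
  have "conj (conj x) * conj x = x * conj x"
    using conj_mult_self[of "conj x"] conj_mult_self[of x] by (simp add: norm_conj mult.commute)
  then show ?thesis using \<open>conj x \<noteq> 0\<close> by simp
qed (simp add: conj_zero)

lemma conj_scaleR: "conj (r *\<^sub>R (x::'k::real_or_complex)) = r *\<^sub>R conj x"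
  by (simp add: scaleR_conv_of_real conj_mult conj_of_real)

lemma bounded_linear_conj: "bounded_linear (conj :: 'k \<Rightarrow> 'k::real_or_complex)"
  by (rule bounded_linear_intro[of _ 1]) (auto simp: conj_add conj_scaleR norm_conj)

lemma conj_diff: "conj (x - y) = conj x - conj (y::'k::real_or_complex)"
  by (rule linear_diff[OF bounded_linear.linear[OF bounded_linear_conj]])

text \<open>Polarization of \<open>conj x * x\<close> between \<open>1\<close> and \<open>x\<close> exhibits the real part as a real number.\<close>

definition re_part :: "'k::real_or_complex \<Rightarrow> real"
  where "re_part x = ((norm (1 + x))\<^sup>2 - 1 - (norm x)\<^sup>2) / 2"

lemma add_conj: "x + conj x = (of_real (2 * re_part x) :: 'k::real_or_complex)"
proof -
  have "1 + x + conj x + conj x * x = of_real ((norm (1 + x))\<^sup>2)"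
    using conj_mult_self[of "1 + x"] by (simp add: conj_add conj_one algebra_simps scaleR_conv_of_real)
  then have "x + conj x = of_real ((norm (1 + x))\<^sup>2) - 1 - conj x * x"
    by (simp add: algebra_simps)
  then show ?thesis
    by (simp add: re_part_def conj_mult_self scaleR_conv_of_real)
qed

text \<open>\<open>x + conj x\<close> determines the real part, so its algebraic laws follow from
  those of \<open>conj\<close>, without computing with the squared norms in the definition.\<close>

lemma re_part_eqI: "x + conj x = (of_real (2 * r) :: 'k::real_or_complex) \<Longrightarrow> re_part x = r"
  unfolding add_conj of_real_eq_iff by simp

lemma re_part_add: "re_part (x + y) = re_part x + re_part (y::'k::real_or_complex)"
proof (rule re_part_eqI)
  have "x + y + conj (x + y) = (x + conj x) + (y + conj y)"
    by (simp add: conj_add)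
  also have "\<dots> = of_real (2 * (re_part x + re_part y))"
    by (simp only: add_conj of_real_add[symmetric] distrib_left)
  finally show "x + y + conj (x + y) = of_real (2 * (re_part x + re_part y))" .
qed

lemma re_part_scaleR: "re_part (r *\<^sub>R (x::'k::real_or_complex)) = r * re_part x"
proof (rule re_part_eqI)
  have "r *\<^sub>R x + conj (r *\<^sub>R x) = r *\<^sub>R (x + conj x)"
    by (simp add: conj_scaleR scaleR_add_right)
  then show "r *\<^sub>R x + conj (r *\<^sub>R x) = of_real (2 * (r * re_part x))"
    by (simp add: add_conj scaleR_conv_of_real)
qed

lemma abs_re_part_le: "\<bar>re_part x\<bar> \<le> norm (x::'k::real_or_complex)"
  using norm_triangle_ineq[of x "conj x"] unfolding add_conj by (simp add: norm_conj abs_mult)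

lemma re_part_conj: "re_part (conj x) = re_part (x::'k::real_or_complex)"
proof (rule re_part_eqI)
  show "conj x + conj (conj x) = of_real (2 * re_part x)"
    unfolding add_conj[symmetric] conj_conj by (rule add.commute)
qed

lemma re_part_of_real: "re_part (of_real r :: 'k::real_or_complex) = r"
  by (rule re_part_eqI) (simp add: conj_of_real)

lemma bounded_linear_re_part: "bounded_linear (re_part :: 'k::real_or_complex \<Rightarrow> real)"
  by (rule bounded_linear_intro[of _ 1]) (auto simp: re_part_add re_part_scaleR abs_re_part_le)

lemma re_part_diff: "re_part (x - y) = re_part x - re_part (y::'k::real_or_complex)"
  by (rule linear_diff[OF bounded_linear.linear[OF bounded_linear_re_part]])

lemma of_real_re_part: "conj x = x \<Longrightarrow> of_real (re_part x) = (x::'k::real_or_complex)"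
  using add_conj[of x] by simp

lemma re_part_nonneg: "x \<in> \<real>\<^sub>\<ge>\<^sub>0 \<Longrightarrow> re_part (x::'k::real_or_complex) \<ge> 0"
  unfolding nonneg_Reals_def by (auto simp: re_part_of_real)

text \<open>For nonzero \<open>x\<close> the scalar is \<open>x\<close> divided by its norm.
  Functionals in the dual space are conjugate-linear, so scaling the argument by \<open>c\<close>
  multiplies a pairing by \<open>conj c\<close> and turns its modulus into a real part.\<close>

lemma rotate_to_norm:
  obtains c :: "'k::real_or_complex" where "norm c = 1" "conj c * x = of_real (norm x)"
proof (cases "x = 0")
  case True
  then show ?thesis using that[of 1] by simp
next
  case False
  have "conj (inverse (norm x) *\<^sub>R x) * x = inverse (norm x) *\<^sub>R (conj x * x)"
    by (simp only: conj_scaleR mult_scaleR_left)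
  also have "\<dots> = of_real (norm x)"
    using False by (simp add: conj_mult_self of_real_def power2_eq_square)
  finally have "conj (inverse (norm x) *\<^sub>R x) * x = of_real (norm x)" .
  then show ?thesis using that[of "inverse (norm x) *\<^sub>R x"] False by simp
qed

lemma operatorsD:
  assumes "A \<in> operators s1 S1 s2 S2" and "x \<in> S1"
  shows "A x \<in> S2" and "y \<in> S1 \<Longrightarrow> A (x + y) = A x + A y" and "A (s1 c x) = s2 c (A x)"
  using assms by (auto simp: operators_def)

lemma operators_continuous: "A \<in> operators s1 S1 s2 S2 \<Longrightarrow> continuous_on S1 A"
  by (simp add: operators_def)

lemma dual_scl_of_real: "dual_scl (of_real r) y = r *\<^sub>R y"
  by (rule blinfun_eqI) (simp add: dual_scl_pairing blinfun.scaleR_left scaleR_conv_of_real)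

section \<open>The dual space, bounds for operators and quadratic forms\<close>

context banach_over
begin

abbreviation "D \<equiv> dual scl"

lemma dualD: "y \<in> D \<Longrightarrow> \<langle>y, scl c x\<rangle> = conj c * \<langle>y, x\<rangle>"
  by (simp add: dual_def)

lemma subspace_dual: "real_vector.subspace D"
  unfolding real_vector.subspace_def dual_def
  by (auto simp: blinfun.add_left blinfun.scaleR_left blinfun.zero_left algebra_simps scaleR_right_distrib)

lemma closed_dual: "closed D"
proof -
  have "D = (\<Inter>c x. {y. \<langle>y, scl c x\<rangle> = conj c * \<langle>y, x\<rangle>})"
    by (auto simp: dual_def)
  moreover have "closed {y :: 'a \<Rightarrow>\<^sub>L 'k. \<langle>y, scl c x\<rangle> = conj c * \<langle>y, x\<rangle>}" for c x
    by (intro closed_Collect_eq continuous_intros)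
  ultimately show ?thesis
    by (auto intro!: closed_INT)
qed

lemma operators_scaleR:
  assumes "A \<in> operators scl S1 s2 S2" "\<And>r y. s2 (of_real r) y = r *\<^sub>R y" "x \<in> S1"
  shows "A (r *\<^sub>R x) = r *\<^sub>R A x"
  using operatorsD(3)[OF assms(1,3), of "of_real r"] by (simp add: assms scl_of_real)

lemma L_X_dual_simps:
  assumes "A \<in> L_X_dual scl"
  shows "A x \<in> D" "A (x + y) = A x + A y" "A (r *\<^sub>R x) = r *\<^sub>R A x" "A (x - y) = A x - A y"
    "A (- x) = - A x" "A 0 = 0" "A (scl c x) = dual_scl c (A x)"
proof -
  interpret A: linear A
    using operatorsD(2)[OF assms] operators_scaleR[OF assms dual_scl_of_real]
    by (intro linearI) auto
  show "A x \<in> D" "A (x + y) = A x + A y" "A (r *\<^sub>R x) = r *\<^sub>R A x" "A (x - y) = A x - A y"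
    "A (- x) = - A x" "A 0 = 0" "A (scl c x) = dual_scl c (A x)"
    using operatorsD[OF assms] by (simp_all add: A.add A.scaleR A.diff A.neg A.zero)
qed

lemma L_X_X_linear:
  assumes "A \<in> L_X_X scl"
  shows "linear A"
  using operatorsD(2)[OF assms] operators_scaleR[OF assms scl_of_real] by (intro linearI) auto

text \<open>A norm bound stands in for continuity, since this is what integrals and limits of
  operators deliver.\<close>

lemma L_X_dualI:
  assumes "\<And>x. A x \<in> D" "\<And>x y. A (x + y) = A x + A y" "\<And>c x. A (scl c x) = dual_scl c (A x)"
    and bound: "\<And>x. norm (A x) \<le> R * norm x"
  shows "A \<in> L_X_dual scl"
proof -
  have "A (r *\<^sub>R x) = r *\<^sub>R A x" for r x
    using assms(3)[of "of_real r" x] by (simp add: scl_of_real dual_scl_of_real)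
  then have "bounded_linear A"
    using assms(2) bound by (intro bounded_linear_intro[of _ R]) (auto simp: mult.commute)
  then show ?thesis
    using assms by (auto simp: operators_def linear_continuous_on)
qed

lemma uniformly_bounded_L_X_dual:
  assumes A: "\<And>i. i \<in> I \<Longrightarrow> A i \<in> L_X_dual scl" and bdd: "\<And>x. bounded ((\<lambda>i. A i x) ` I)"
  obtains K where "K > 0" "\<And>i x. i \<in> I \<Longrightarrow> norm (A i x) \<le> K * norm x"
proof (rule uniform_boundedness_on[of UNIV I A])
  show "A i (x + y) = A i x + A i y" if "i \<in> I" for i x y
    using L_X_dual_simps(2)[OF A[OF that]] .
  show "A i (r *\<^sub>R x) = r *\<^sub>R A i x" if "i \<in> I" for i x r
    using L_X_dual_simps(3)[OF A[OF that]] .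
  show "continuous_on UNIV (A i)" if "i \<in> I" for i
    using A[OF that] by (rule operators_continuous)
  show "bounded ((\<lambda>i. A i x) ` I)" for x by (rule bdd)
qed (auto intro: that)

lemma uniformly_bounded_L_dual_X:
  assumes A: "\<And>i. i \<in> I \<Longrightarrow> A i \<in> L_dual_X scl" and bdd: "\<And>y. y \<in> D \<Longrightarrow> bounded ((\<lambda>i. A i y) ` I)"
  obtains K where "K > 0" "\<And>i y. i \<in> I \<Longrightarrow> y \<in> D \<Longrightarrow> norm (A i y) \<le> K * norm y"
proof (rule uniform_boundedness_on[of D I A])
  show "A i (x + y) = A i x + A i y" if "i \<in> I" "x \<in> D" "y \<in> D" for i x y
    using operatorsD(2)[OF A[OF that(1)] that(2,3)] .
  show "A i (r *\<^sub>R x) = r *\<^sub>R A i x" if "i \<in> I" "x \<in> D" for i x r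
    using operatorsD(3)[OF A[OF that(1)] that(2), of "of_real r"]
    by (simp add: dual_scl_of_real scl_of_real)
  show "continuous_on D (A i)" if "i \<in> I" for i
    using A[OF that] by (rule operators_continuous)
  show "bounded ((\<lambda>i. A i x) ` I)" if "x \<in> D" for x using that by (rule bdd)
qed (use that closed_dual subspace_dual in blast)+

text \<open>A general Banach space has no parallelogram law. For unit vectors, polarization writes
  four times the real part of the pairing as a difference of two values of the form. Nonnegativity
  discards the subtracted one and \<open>norm (x + y) \<le> 2\<close> bounds the other by
  \<open>4 * \<beta>\<close>, so no factor is lost.\<close>

lemma norm_le_of_quadratic_form_le:
  assumes sa: "selfadjoint_X_dual scl A"
    and q: "\<And>x. re_part \<langle>A x, x\<rangle> \<ge> 0" "\<And>x. re_part \<langle>A x, x\<rangle> \<le> \<beta> * (norm x)\<^sup>2"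
  shows "norm (A x) \<le> \<beta> * norm x"
proof -
  have A: "A \<in> L_X_dual scl" and sym: "\<And>x y. \<langle>A x, y\<rangle> = conj \<langle>A y, x\<rangle>"
    using sa unfolding selfadjoint_X_dual_def is_adjoint_X_dual_def by blast+
  note lin = L_X_dual_simps[OF A]
  have re: "re_part \<langle>A x, y\<rangle> \<le> \<beta>" if "norm x = 1" "norm y = 1" for x y
  proof -
    have \<beta>: "\<beta> \<ge> 0" using order_trans[OF q(1)[of x] q(2)[of x]] that(1) by simp
    have "re_part \<langle>A y, x\<rangle> = re_part \<langle>A x, y\<rangle>"
      by (subst sym) (rule re_part_conj)
    then have "4 * re_part \<langle>A x, y\<rangle> = re_part \<langle>A (x + y), x + y\<rangle> - re_part \<langle>A (x - y), x - y\<rangle>"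
      unfolding lin(2,4) blinfun.add_left blinfun.add_right blinfun.diff_left blinfun.diff_right
        re_part_add re_part_diff by linarith
    also have "\<dots> \<le> \<beta> * (norm (x + y))\<^sup>2"
      using q(1)[of "x - y"] q(2)[of "x + y"] by simp
    also have "\<dots> \<le> \<beta> * 2\<^sup>2"
      using norm_triangle_ineq[of x y] that \<beta> by (intro mult_left_mono power_mono) auto
    finally show ?thesis by simp
  qed
  have unit: "norm \<langle>A x, y\<rangle> \<le> \<beta>" if xy: "norm x = 1" "norm y = 1" for x y
  proof -
    obtain c where c: "norm c = 1" "conj c * \<langle>A x, y\<rangle> = of_real (norm \<langle>A x, y\<rangle>)"
      by (rule rotate_to_norm)
    then have "re_part \<langle>A x, scl c y\<rangle> = norm \<langle>A x, y\<rangle>"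
      by (simp add: dualD[OF lin(1)] re_part_of_real)
    moreover have "re_part \<langle>A x, scl c y\<rangle> \<le> \<beta>"
      using xy c by (intro re) (auto simp: norm_scl)
    ultimately show ?thesis by simp
  qed
  have "norm \<langle>A x, y\<rangle> \<le> \<beta> * norm x * norm y" for y
  proof (cases "x = 0 \<or> y = 0")
    case True
    then show ?thesis by (auto simp: lin blinfun.zero_right)
  next
    case False
    then have "norm \<langle>A (x /\<^sub>R norm x), y /\<^sub>R norm y\<rangle> \<le> \<beta>"
      by (intro unit) auto
    moreover have "\<langle>A (x /\<^sub>R norm x), y /\<^sub>R norm y\<rangle> = (1 / (norm x * norm y)) *\<^sub>R \<langle>A x, y\<rangle>"
      by (simp only: lin(3) blinfun.scaleR_left blinfun.scaleR_right) (simp add: divide_simps)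
    ultimately have "norm \<langle>A x, y\<rangle> / (norm x * norm y) \<le> \<beta>"
      by simp
    moreover have "norm x * norm y > 0"
      using False by simp
    ultimately show ?thesis
      by (simp only: pos_divide_le_eq mult.assoc)
  qed
  \<comment> \<open>In the trivial space \<open>\<beta>\<close> may be negative; its sign is read
    off from the form at \<open>x\<close> when \<open>x\<close> is nonzero.\<close>
  moreover have "\<beta> * norm x \<ge> 0"
  proof (cases "x = 0")
    case False
    then have "\<beta> * (norm x)\<^sup>2 \<ge> 0" "norm x > 0" using order_trans[OF q(1)[of x] q(2)[of x]] by auto
    then show ?thesis by (simp add: zero_le_mult_iff)
  qed simp
  ultimately show ?thesis
    by (intro norm_blinfun_bound) auto
qed

end

section \<open>The affine Volterra operator\<close>

text \<open>The uniform bounds are parameters because interval lengths and exponential weights are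
  computed from them; they are positive so that they may occur in divisors.\<close>

locale riccati_data = banach_over scl
  for scl :: "'k::real_or_complex \<Rightarrow> 'a::banach \<Rightarrow> 'a" +
  fixes T :: real
    and U :: "real \<Rightarrow> real \<Rightarrow> 'a \<Rightarrow> 'a"
    and V :: "real \<Rightarrow> real \<Rightarrow> ('a \<Rightarrow>\<^sub>L 'k) \<Rightarrow> ('a \<Rightarrow>\<^sub>L 'k)"
    and C :: "real \<Rightarrow> 'a \<Rightarrow> ('a \<Rightarrow>\<^sub>L 'k)"
    and B :: "real \<Rightarrow> ('a \<Rightarrow>\<^sub>L 'k) \<Rightarrow> 'a"
    and M kC kB :: real
  assumes T_nonneg: "T \<ge> 0"
    and U_op: "\<And>s t. 0 \<le> s \<Longrightarrow> s \<le> t \<Longrightarrow> t \<le> T \<Longrightarrow> U t s \<in> L_X_X scl"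
    and U_refl: "\<And>s x. 0 \<le> s \<Longrightarrow> s \<le> T \<Longrightarrow> U s s x = x"
    and U_trans: "\<And>s r t x. 0 \<le> s \<Longrightarrow> s \<le> r \<Longrightarrow> r \<le> t \<Longrightarrow> t \<le> T \<Longrightarrow> U t r (U r s x) = U t s x"
    and U_cont1: "\<And>s x. 0 \<le> s \<Longrightarrow> s \<le> T \<Longrightarrow> continuous_on {s..T} (\<lambda>t. U t s x)"
    and U_cont2: "\<And>t x. 0 \<le> t \<Longrightarrow> t \<le> T \<Longrightarrow> continuous_on {0..t} (\<lambda>s. U t s x)"
    and M_pos: "M > 0"
    and U_bound: "\<And>s t x. 0 \<le> s \<Longrightarrow> s \<le> t \<Longrightarrow> t \<le> T \<Longrightarrow> norm (U t s x) \<le> M * norm x"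
    and V_adj: "\<And>t s. 0 \<le> t \<Longrightarrow> t \<le> s \<Longrightarrow> s \<le> T \<Longrightarrow> is_adjoint_X_X scl (U s t) (V t s)"
    and V_cont1: "\<And>s y. y \<in> dual scl \<Longrightarrow> 0 \<le> s \<Longrightarrow> s \<le> T \<Longrightarrow> continuous_on {0..s} (\<lambda>t. V t s y)"
    and V_cont2: "\<And>t y. y \<in> dual scl \<Longrightarrow> 0 \<le> t \<Longrightarrow> t \<le> T \<Longrightarrow> continuous_on {t..T} (\<lambda>s. V t s y)"
    and C_op: "\<And>t. 0 \<le> t \<Longrightarrow> t \<le> T \<Longrightarrow> C t \<in> L_X_dual scl"
    and C_cont: "\<And>x. continuous_on {0..T} (\<lambda>t. C t x)"
    and kC_pos: "kC > 0"
    and C_bound: "\<And>t x. 0 \<le> t \<Longrightarrow> t \<le> T \<Longrightarrow> norm (C t x) \<le> kC * norm x"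
    and C_selfadjoint: "\<And>t. 0 \<le> t \<Longrightarrow> t \<le> T \<Longrightarrow> selfadjoint_X_dual scl (C t)"
    and C_nonneg: "\<And>t. 0 \<le> t \<Longrightarrow> t \<le> T \<Longrightarrow> nonneg_X_dual (C t)"
    and B_op: "\<And>t. 0 \<le> t \<Longrightarrow> t \<le> T \<Longrightarrow> B t \<in> L_dual_X scl"
    and B_cont: "\<And>y. y \<in> dual scl \<Longrightarrow> continuous_on {0..T} (\<lambda>t. B t y)"
    and kB_pos: "kB > 0"
    and B_bound: "\<And>t y. 0 \<le> t \<Longrightarrow> t \<le> T \<Longrightarrow> y \<in> dual scl \<Longrightarrow> norm (B t y) \<le> kB * norm y"
    and B_selfadjoint: "\<And>t. 0 \<le> t \<Longrightarrow> t \<le> T \<Longrightarrow> selfadjoint_dual_X scl (B t)"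
    and B_nonneg: "\<And>t. 0 \<le> t \<Longrightarrow> t \<le> T \<Longrightarrow> nonneg_dual_X scl (B t)"
begin

lemma U_linear: "0 \<le> s \<Longrightarrow> s \<le> t \<Longrightarrow> t \<le> T \<Longrightarrow> linear (U t s)"
  using L_X_X_linear[OF U_op] .

lemmas U_add = linear_add[OF U_linear] and U_diff = linear_diff[OF U_linear]

lemma U_scl: "0 \<le> s \<Longrightarrow> s \<le> t \<Longrightarrow> t \<le> T \<Longrightarrow> U t s (scl c x) = scl c (U t s x)"
  using operatorsD(3)[OF U_op] by blast

lemma U_bound_diff:
  "0 \<le> s \<Longrightarrow> s \<le> t \<Longrightarrow> t \<le> T \<Longrightarrow> norm (U t s x - U t s y) \<le> M * norm (x - y)"
  using U_bound[of s t "x - y"] by (simp add: U_diff)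

lemma V_pairing:
  "0 \<le> t \<Longrightarrow> t \<le> s \<Longrightarrow> s \<le> T \<Longrightarrow> y \<in> D \<Longrightarrow> \<langle>V t s y, x\<rangle> = \<langle>y, U s t x\<rangle>"
  using V_adj unfolding is_adjoint_X_X_def by blast

lemma V_bound:
  assumes "0 \<le> t" "t \<le> s" "s \<le> T" "y \<in> D"
  shows "norm (V t s y) \<le> M * norm y"
proof (rule norm_blinfun_bound)
  fix x
  have "norm \<langle>y, U s t x\<rangle> \<le> norm y * norm (U s t x)"
    by (rule norm_blinfun)
  also have "\<dots> \<le> norm y * (M * norm x)"
    by (intro mult_left_mono U_bound assms) auto
  finally show "norm \<langle>V t s y, x\<rangle> \<le> M * norm y * norm x"
    by (simp add: V_pairing[OF assms] mult_ac)
qed (use M_pos in simp)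

lemma dual_diff: "y \<in> D \<Longrightarrow> z \<in> D \<Longrightarrow> y - z \<in> D"
  using real_vector.subspace_diff[OF subspace_dual] .

lemma V_diff:
  assumes "0 \<le> t" "t \<le> s" "s \<le> T" "y \<in> D" "z \<in> D"
  shows "V t s y - V t s z = V t s (y - z)"
  by (rule blinfun_eqI) (simp add: V_pairing assms dual_diff blinfun.diff_left)

lemma V_bound_diff:
  "0 \<le> t \<Longrightarrow> t \<le> s \<Longrightarrow> s \<le> T \<Longrightarrow> y \<in> D \<Longrightarrow> z \<in> D \<Longrightarrow>
    norm (V t s y - V t s z) \<le> M * norm (y - z)"
  using V_bound[of t s "y - z"] by (simp add: V_diff dual_diff)

lemma B_diff:
  assumes "0 \<le> t" "t \<le> T" "y \<in> D" "z \<in> D"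
  shows "B t y - B t z = B t (y - z)"
  using operatorsD(2)[OF B_op[OF assms(1,2)] dual_diff[OF assms(3,4)] assms(4)] by simp

lemma B_bound_diff:
  "0 \<le> t \<Longrightarrow> t \<le> T \<Longrightarrow> y \<in> D \<Longrightarrow> z \<in> D \<Longrightarrow> norm (B t y - B t z) \<le> kB * norm (y - z)"
  using B_bound[of t "y - z"] by (simp add: B_diff dual_diff)

text \<open>The ball of radius \<open>R\<close> in the space of strongly continuous operator
  functions on a subinterval. The radius is recorded because the quadratic term is Lipschitz only on
  balls.\<close>

definition opfun :: "real \<Rightarrow> real \<Rightarrow> real \<Rightarrow> (real \<Rightarrow> 'a \<Rightarrow> ('a \<Rightarrow>\<^sub>L 'k)) \<Rightarrow> bool"
  where "opfun a b R P \<longleftrightarrow> (\<forall>t\<in>{a..b}. P t \<in> L_X_dual scl \<and> (\<forall>x. norm (P t x) \<le> R * norm x)) \<and>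
    (\<forall>x. continuous_on {a..b} (\<lambda>t. P t x))"

lemma opfunD:
  assumes "opfun a b R P"
  shows "a \<le> t \<Longrightarrow> t \<le> b \<Longrightarrow> P t \<in> L_X_dual scl"
    and "a \<le> t \<Longrightarrow> t \<le> b \<Longrightarrow> norm (P t x) \<le> R * norm x"
    and "continuous_on {a..b} (\<lambda>t. P t x)"
    and "a \<le> t \<Longrightarrow> t \<le> b \<Longrightarrow> P t x \<in> D"
    and "a \<le> t \<Longrightarrow> t \<le> b \<Longrightarrow> norm (P t x - P t y) \<le> R * norm (x - y)"
proof -
  show *: "a \<le> t \<Longrightarrow> t \<le> b \<Longrightarrow> P t \<in> L_X_dual scl"
    and **: "\<And>x. a \<le> t \<Longrightarrow> t \<le> b \<Longrightarrow> norm (P t x) \<le> R * norm x"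
    and "continuous_on {a..b} (\<lambda>t. P t x)"
    using assms by (auto simp: opfun_def)
  show "a \<le> t \<Longrightarrow> t \<le> b \<Longrightarrow> P t x \<in> D"
    using L_X_dual_simps(1)[OF *] .
  show "a \<le> t \<Longrightarrow> t \<le> b \<Longrightarrow> norm (P t x - P t y) \<le> R * norm (x - y)"
    using **[of "x - y"] by (simp add: L_X_dual_simps(4)[OF *])
qed

lemma opfun_subset: "opfun a b R P \<Longrightarrow> a \<le> a' \<Longrightarrow> b' \<le> b \<Longrightarrow> opfun a' b' R P"
  unfolding opfun_def by (auto intro: continuous_on_subset)

lemma opfun_apply_continuous:
  assumes "opfun a b R P" "a \<le> a'" "b' \<le> b" "continuous_on {a'..b'} f"
  shows "continuous_on {a'..b'} (\<lambda>t. P t (f t))"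
proof (rule continuous_on_strong_apply[OF assms(4), where D = UNIV and M = R])
  note P = opfun_subset[OF assms(1-3)]
  show "continuous_on {a'..b'} (\<lambda>t. P t y)" for y
    by (rule opfunD(3)[OF P])
  show "norm (P r y - P r z) \<le> R * norm (y - z)" if "r \<in> {a'..b'}" for r y z
    using that by (intro opfunD(5)[OF P]) auto
qed auto

lemma B_apply_continuous:
  assumes "0 \<le> a" "b \<le> T" "continuous_on {a..b} f" "\<And>t. t \<in> {a..b} \<Longrightarrow> f t \<in> D"
  shows "continuous_on {a..b} (\<lambda>t. B t (f t))"
proof (rule continuous_on_strong_apply[OF assms(3), where D = D and M = kB])
  show "continuous_on {a..b} (\<lambda>r. B r y)" if "y \<in> D" for y
    by (rule continuous_on_subset[OF B_cont[OF that]]) (use assms(1,2) in auto)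
  show "norm (B r y - B r z) \<le> kB * norm (y - z)" if "r \<in> {a..b}" "y \<in> D" "z \<in> D" for r y z
    using that assms(1,2) by (intro B_bound_diff) auto
qed (rule assms(4))

text \<open>The right-hand side of the integral equation for a given source \<open>K\<close>; the
  Riccati equation is the fixed point equation of \<open>Lam b H (source P)\<close>. Terminal time
  and terminal operator are free so that the equation can be restarted at an intermediate
  time.\<close>

definition Lam :: "real \<Rightarrow> ('a \<Rightarrow> ('a \<Rightarrow>\<^sub>L 'k)) \<Rightarrow> (real \<Rightarrow> 'a \<Rightarrow> ('a \<Rightarrow>\<^sub>L 'k)) \<Rightarrow> real \<Rightarrow> 'a \<Rightarrow> ('a \<Rightarrow>\<^sub>L 'k)"
  where "Lam b H K t x = V t b (H (U b t x)) + integral {t..b} (\<lambda>r. V t r (K r (U r t x)))"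

definition source :: "(real \<Rightarrow> 'a \<Rightarrow> ('a \<Rightarrow>\<^sub>L 'k)) \<Rightarrow> real \<Rightarrow> 'a \<Rightarrow> ('a \<Rightarrow>\<^sub>L 'k)"
  where "source P r x = C r x - P r (B r (P r x))"

context
  fixes a b R :: real and K :: "real \<Rightarrow> 'a \<Rightarrow> ('a \<Rightarrow>\<^sub>L 'k)" and H :: "'a \<Rightarrow> ('a \<Rightarrow>\<^sub>L 'k)"
  assumes K: "opfun a b R K" and ab: "0 \<le> a" "b \<le> T"
begin

lemma KU_continuous:
  assumes "a \<le> t" "t \<le> b"
  shows "continuous_on {t..b} (\<lambda>r. K r (U r t x))"
proof (rule opfun_apply_continuous[OF K])
  show "continuous_on {t..b} (\<lambda>r. U r t x)"
    by (rule continuous_on_subset[OF U_cont1]) (use assms ab in auto)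
qed (use assms in auto)

lemma VKU_continuous:
  assumes "a \<le> t" "t \<le> b"
  shows "continuous_on {t..b} (\<lambda>r. V t r (K r (U r t x)))"
proof (rule continuous_on_strong_apply[OF KU_continuous[OF assms], where D = D and M = M])
  show "continuous_on {t..b} (\<lambda>r. V t r y)" if "y \<in> D" for y
    by (rule continuous_on_subset[OF V_cont2[OF that]]) (use assms ab in auto)
  show "K r (U r t x) \<in> D" if "r \<in> {t..b}" for r
    using that assms by (intro opfunD(4)[OF K]) auto
  show "norm (V t r y - V t r z) \<le> M * norm (y - z)" if "r \<in> {t..b}" "y \<in> D" "z \<in> D" for r y z
    using that assms ab by (intro V_bound_diff) auto
qed

lemma VKU_integrable:
  "a \<le> t \<Longrightarrow> t \<le> b \<Longrightarrow> (\<lambda>r. V t r (K r (U r t x))) integrable_on {t..b}"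
  by (intro integrable_continuous_real VKU_continuous)

lemma pairing_integrable:
  assumes "a \<le> t" "t \<le> b"
  shows "(\<lambda>r. \<langle>K r (U r t x), U r t y\<rangle>) integrable_on {t..b}"
proof -
  have "continuous_on {t..b} (\<lambda>r. U r t y)"
    by (rule continuous_on_subset[OF U_cont1]) (use assms ab in auto)
  then show ?thesis
    by (intro integrable_continuous_real blinfun.continuous_on KU_continuous assms)
qed

text \<open>Moving \<open>V\<close> to the other side as \<open>U\<close> leaves scalar integrals of
  forms at \<open>U r t x\<close> and \<open>U r t y\<close>. Linearity, symmetry and the restart
  property of \<open>Lam\<close> are read off from these.\<close>

lemma Lam_pairing:
  assumes H: "\<And>x. H x \<in> D" and t: "a \<le> t" "t \<le> b"
  shows "\<langle>Lam b H K t x, y\<rangle> = \<langle>H (U b t x), U b t y\<rangle> + integral {t..b} (\<lambda>r. \<langle>K r (U r t x), U r t y\<rangle>)"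
proof -
  have "\<langle>integral {t..b} (\<lambda>r. V t r (K r (U r t x))), y\<rangle> = integral {t..b} (\<lambda>r. \<langle>V t r (K r (U r t x)), y\<rangle>)"
    by (rule blinfun_apply_integral[OF VKU_integrable[OF t]])
  also have "\<dots> = integral {t..b} (\<lambda>r. \<langle>K r (U r t x), U r t y\<rangle>)"
    using t ab opfunD(4)[OF K] by (intro integral_cong V_pairing) auto
  finally show ?thesis
    using t ab by (simp add: Lam_def blinfun.add_left V_pairing H)
qed

lemma Lam_bound:
  assumes H: "\<And>x. H x \<in> D" "\<And>x. norm (H x) \<le> h * norm x" "h \<ge> 0" and R: "R \<ge> 0"
    and t: "a \<le> t" "t \<le> b"
  shows "norm (Lam b H K t x) \<le> M\<^sup>2 * (h + R * (b - t)) * norm x"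
proof -
  have "norm (V t b (H (U b t x))) \<le> M * (h * (M * norm x))"
    using t ab H M_pos
    by (intro order_trans[OF V_bound] mult_left_mono order_trans[OF H(2)] U_bound) auto
  moreover have "norm (integral {t..b} (\<lambda>r. V t r (K r (U r t x)))) \<le> M * (R * (M * norm x)) * (b - t)"
    using t ab M_pos R opfunD[OF K]
    by (intro integral_bound VKU_continuous order_trans[OF V_bound] mult_left_mono
        order_trans[OF opfunD(2)[OF K]] U_bound) auto
  ultimately show ?thesis
    unfolding Lam_def
    by (intro order_trans[OF norm_triangle_ineq]) (simp add: algebra_simps power2_eq_square)
qed

lemma Lam_operator:
  assumes H: "H \<in> L_X_dual scl" "\<And>x. norm (H x) \<le> h * norm x" "h \<ge> 0" and R: "R \<ge> 0"
    and t: "a \<le> t" "t \<le> b"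
  shows "Lam b H K t \<in> L_X_dual scl"
proof (rule L_X_dualI)
  note Hl = L_X_dual_simps[OF H(1)]
  note Kl = L_X_dual_simps[OF opfunD(1)[OF K]]
  note pair = Lam_pairing[OF Hl(1) t]
  have ts: "0 \<le> t" "b \<le> T" using t ab by auto
  show "Lam b H K t x \<in> D" for x
    unfolding dual_def mem_Collect_eq
  proof (intro allI)
    fix c y
    have "integral {t..b} (\<lambda>r. \<langle>K r (U r t x), U r t (scl c y)\<rangle>)
        = integral {t..b} (\<lambda>r. conj c * \<langle>K r (U r t x), U r t y\<rangle>)"
      using t ts by (intro integral_cong) (auto simp: U_scl dualD[OF Kl(1)])
    then show "\<langle>Lam b H K t x, scl c y\<rangle> = conj c * \<langle>Lam b H K t x, y\<rangle>"
      using t ts by (simp add: pair U_scl dualD[OF Hl(1)] distrib_left)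
  qed
  show "Lam b H K t (x + y) = Lam b H K t x + Lam b H K t y" for x y
  proof (rule blinfun_eqI)
    fix z
    have "integral {t..b} (\<lambda>r. \<langle>K r (U r t (x + y)), U r t z\<rangle>)
        = integral {t..b} (\<lambda>r. \<langle>K r (U r t x), U r t z\<rangle> + \<langle>K r (U r t y), U r t z\<rangle>)"
      using t ts by (intro integral_cong) (auto simp: U_add Kl(2) blinfun.add_left)
    then show "\<langle>Lam b H K t (x + y), z\<rangle> = \<langle>Lam b H K t x + Lam b H K t y, z\<rangle>"
      using t ts
      by (simp add: pair U_add Hl(2) blinfun.add_left integral_add[OF pairing_integrable[OF t] pairing_integrable[OF t]])
  qed
  show "Lam b H K t (scl c x) = dual_scl c (Lam b H K t x)" for c x
  proof (rule blinfun_eqI)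
    fix z
    have "integral {t..b} (\<lambda>r. \<langle>K r (U r t (scl c x)), U r t z\<rangle>)
        = integral {t..b} (\<lambda>r. c * \<langle>K r (U r t x), U r t z\<rangle>)"
      using t ts by (intro integral_cong) (auto simp: U_scl Kl(7) dual_scl_pairing)
    then show "\<langle>Lam b H K t (scl c x), z\<rangle> = \<langle>dual_scl c (Lam b H K t x), z\<rangle>"
      using t ts by (simp add: pair U_scl Hl(7) dual_scl_pairing distrib_left)
  qed
  show "norm (Lam b H K t x) \<le> M\<^sup>2 * (h + R * (b - t)) * norm x" for x
    by (rule Lam_bound) (use assms Hl(1) in auto)
qed

lemma Lam_selfadjoint:
  assumes H: "selfadjoint_X_dual scl H" "\<And>x. norm (H x) \<le> h * norm x" "h \<ge> 0" and R: "R \<ge> 0"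
    and Ksa: "\<And>r. a \<le> r \<Longrightarrow> r \<le> b \<Longrightarrow> selfadjoint_X_dual scl (K r)"
    and t: "a \<le> t" "t \<le> b"
  shows "selfadjoint_X_dual scl (Lam b H K t)"
  unfolding selfadjoint_X_dual_def is_adjoint_X_dual_def
proof (intro conjI allI)
  have Hop: "H \<in> L_X_dual scl"
    using H(1) by (simp add: selfadjoint_X_dual_def is_adjoint_X_dual_def)
  show "Lam b H K t \<in> L_X_dual scl"
    by (rule Lam_operator) (use assms Hop in auto)
  fix x y
  have H': "\<langle>H z, w\<rangle> = conj \<langle>H w, z\<rangle>" for z w
    using H(1) unfolding selfadjoint_X_dual_def is_adjoint_X_dual_def by blast
  have K': "\<langle>K r z, w\<rangle> = conj \<langle>K r w, z\<rangle>" if "a \<le> r" "r \<le> b" for r z w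
    using Ksa[OF that] unfolding selfadjoint_X_dual_def is_adjoint_X_dual_def by blast
  have "integral {t..b} (\<lambda>r. \<langle>K r (U r t x), U r t y\<rangle>) = integral {t..b} (\<lambda>r. conj \<langle>K r (U r t y), U r t x\<rangle>)"
    using t by (intro integral_cong K') auto
  also have "\<dots> = conj (integral {t..b} (\<lambda>r. \<langle>K r (U r t y), U r t x\<rangle>))"
    using integral_linear[OF pairing_integrable[OF t] bounded_linear_conj] by (simp add: o_def)
  finally show "\<langle>Lam b H K t x, y\<rangle> = conj \<langle>Lam b H K t y, x\<rangle>"
    unfolding Lam_pairing[OF L_X_dual_simps(1)[OF Hop] t] conj_add
    using H'[of "U b t x" "U b t y"] by simp
qed

text \<open>Restart at \<open>s\<close>: for \<open>r\<close> above \<open>s\<close> the evolution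
  law factors \<open>U r t\<close> through \<open>U s t\<close>, and under the pairing the outer
  \<open>V t s\<close> becomes the second factor \<open>U s t\<close>. Continuity, gluing and
  restriction of solutions rest on this identity.\<close>

lemma Lam_flow:
  assumes H: "\<And>x. H x \<in> D" and L: "\<And>x. Lam b H K s x \<in> D" and t: "a \<le> t" "t \<le> s" "s \<le> b"
  shows "Lam b H K t x = V t s (Lam b H K s (U s t x)) + integral {t..s} (\<lambda>r. V t r (K r (U r t x)))"
proof (rule blinfun_eqI)
  fix y
  have int: "(\<lambda>r. V t r (K r (U r t x))) integrable_on {t..s}"
    by (rule integrable_subinterval_real[OF VKU_integrable]) (use t in auto)
  have "\<langle>integral {t..s} (\<lambda>r. V t r (K r (U r t x))), y\<rangle> = integral {t..s} (\<lambda>r. \<langle>V t r (K r (U r t x)), y\<rangle>)"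
    by (rule blinfun_apply_integral[OF int])
  also have "\<dots> = integral {t..s} (\<lambda>r. \<langle>K r (U r t x), U r t y\<rangle>)"
    using t ab opfunD(4)[OF K] by (intro integral_cong V_pairing) auto
  finally have 1: "\<langle>integral {t..s} (\<lambda>r. V t r (K r (U r t x))), y\<rangle> = integral {t..s} (\<lambda>r. \<langle>K r (U r t x), U r t y\<rangle>)" .
  have "integral {s..b} (\<lambda>r. \<langle>K r (U r s (U s t x)), U r s (U s t y)\<rangle>) = integral {s..b} (\<lambda>r. \<langle>K r (U r t x), U r t y\<rangle>)"
    using t ab by (intro integral_cong) (simp add: U_trans)
  then have 2: "\<langle>V t s (Lam b H K s (U s t x)), y\<rangle>
      = \<langle>H (U b t x), U b t y\<rangle> + integral {s..b} (\<lambda>r. \<langle>K r (U r t x), U r t y\<rangle>)"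
    using t ab by (simp add: V_pairing L Lam_pairing[OF H] U_trans)
  have 3: "integral {t..s} (\<lambda>r. \<langle>K r (U r t x), U r t y\<rangle>) + integral {s..b} (\<lambda>r. \<langle>K r (U r t x), U r t y\<rangle>)
      = integral {t..b} (\<lambda>r. \<langle>K r (U r t x), U r t y\<rangle>)"
    using t by (intro Henstock_Kurzweil_Integration.integral_combine pairing_integrable) auto
  show "\<langle>Lam b H K t x, y\<rangle> = \<langle>V t s (Lam b H K s (U s t x)) + integral {t..s} (\<lambda>r. V t r (K r (U r t x))), y\<rangle>"
    unfolding blinfun.add_left 1 2 using t by (simp add: Lam_pairing[OF H] 3[symmetric])
qed

text \<open>No joint continuity of the evolution family is available: near \<open>t0\<close> the flow identity compares
  \<open>Lam b H K t x\<close> with the continuous function \<open>V t s (Lam b H K s (U s t x))\<close> of \<open>t\<close>, for a fixed \<open>s\<close>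
  slightly above \<open>t0\<close>.\<close>

lemma Lam_continuous:
  assumes H: "H \<in> L_X_dual scl" "\<And>x. norm (H x) \<le> h * norm x" "h \<ge> 0" and R: "R \<ge> 0"
  shows "continuous_on {a..b} (\<lambda>t. Lam b H K t x)"
proof (rule continuous_on_locally_approximable)
  fix t0 e :: real assume t0: "t0 \<in> {a..b}" and "e > 0"
  note Hl = L_X_dual_simps[OF H(1)]
  define q where "q = M * (R * (M * norm x))"
  have q: "q \<ge> 0" using M_pos R by (simp add: q_def)
  \<comment> \<open>The remaining integral has length at most \<open>2 * \<delta>\<close> and an
    integrand bounded by \<open>q\<close>, hence is at most \<open>e\<close>; the \<open>+ 1\<close>
    keeps the divisor positive when \<open>q\<close> is 0.\<close>
  define \<delta> where "\<delta> = e / (2 * (q + 1))"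
  have \<delta>: "\<delta> > 0" using \<open>e > 0\<close> q by (simp add: \<delta>_def)
  define s where "s = min b (t0 + \<delta>)"
  have s: "a \<le> s" "s \<le> b" "s \<le> t0 + \<delta>"
    and below: "{a..b} \<inter> ball t0 \<delta> \<subseteq> {a..s}"
    using t0 \<delta> by (auto simp: s_def dist_real_def)
  let ?L = "Lam b H K s"
  have Lop: "?L \<in> L_X_dual scl"
    by (rule Lam_operator) (use assms s in auto)
  note Ll = L_X_dual_simps[OF Lop]
  define k where "k = M\<^sup>2 * (h + R * (b - s))"
  have k: "norm (?L z) \<le> k * norm z" for z
    unfolding k_def by (rule Lam_bound) (use assms s Hl(1) in auto)
  have "continuous_on {a..s} (\<lambda>t. U s t x)"
    by (rule continuous_on_subset[OF U_cont2]) (use s ab in auto)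
  then have "continuous_on {a..s} (\<lambda>t. ?L (U s t x))"
    by (rule continuous_on_compose2[OF operators_continuous[OF Lop]]) auto
  then have "continuous_on {a..s} (\<lambda>t. V t s (?L (U s t x)))"
  proof (rule continuous_on_strong_apply[where D = D and M = M])
    show "continuous_on {a..s} (\<lambda>t. V t s y)" if "y \<in> D" for y
      by (rule continuous_on_subset[OF V_cont1[OF that]]) (use s ab in auto)
    show "norm (V t s y - V t s z) \<le> M * norm (y - z)" if "t \<in> {a..s}" "y \<in> D" "z \<in> D" for t y z
      using that s ab by (intro V_bound_diff) auto
  qed (rule Ll(1))
  then have "continuous_on ({a..b} \<inter> ball t0 \<delta>) (\<lambda>t. V t s (?L (U s t x)))"
    using below by (rule continuous_on_subset)
  moreover have "norm (Lam b H K t x - V t s (?L (U s t x))) \<le> e" if "t \<in> {a..b} \<inter> ball t0 \<delta>" for t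
  proof -
    have t: "a \<le> t" "t \<le> s" "t \<le> b" using that below by auto
    have "t > t0 - \<delta>" using that by (auto simp: dist_real_def)
    then have "s - t \<le> 2 * \<delta>" using s by simp
    have "norm (integral {t..s} (\<lambda>r. V t r (K r (U r t x)))) \<le> q * (s - t)"
      unfolding q_def using t s ab M_pos R opfunD(4)[OF K]
      by (intro integral_bound continuous_on_subset[OF VKU_continuous[of t]] order_trans[OF V_bound]
          mult_left_mono order_trans[OF opfunD(2)[OF K]] U_bound) auto
    also have "\<dots> \<le> (q + 1) * (2 * \<delta>)"
      using \<open>s - t \<le> 2 * \<delta>\<close> q t \<delta> by (intro mult_mono) auto
    also have "\<dots> = e"
      using q by (simp add: \<delta>_def field_simps)
    finally show ?thesis
      using Lam_flow[OF Hl(1) Ll(1) t(1,2) s(2)] by simp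
  qed
  ultimately show "\<exists>\<delta>>0. \<exists>g. continuous_on ({a..b} \<inter> ball t0 \<delta>) g \<and>
      (\<forall>t\<in>{a..b} \<inter> ball t0 \<delta>. norm (Lam b H K t x - g t) \<le> e)"
    using \<delta> by blast
qed

end

end

section \<open>Local solutions, gluing and uniqueness\<close>

text \<open>Integrating an exponential weight gains the factor \<open>1 / \<mu>\<close>, which beats
  any Lipschitz constant for large \<open>\<mu>\<close>. The weight growing forward from
  \<open>t\<close> serves trajectories, the one growing backward from \<open>b\<close> serves
  operator functions.\<close>

lemma integral_exp_le:
  fixes \<mu> :: real
  assumes "\<mu> > 0" "t \<le> b"
  shows "integral {t..b} (\<lambda>r. exp (\<mu> * (r - t))) \<le> exp (\<mu> * (b - t)) / \<mu>"
    and "integral {t..b} (\<lambda>r. exp (\<mu> * (b - r))) \<le> exp (\<mu> * (b - t)) / \<mu>"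
proof -
  have "((\<lambda>r. exp (\<mu> * (r - t))) has_integral exp (\<mu> * (b - t)) / \<mu> - exp (\<mu> * (t - t)) / \<mu>) {t..b}"
    using assms by (intro fundamental_theorem_of_calculus)
      (auto intro!: derivative_eq_intros simp: has_real_derivative_iff_has_vector_derivative[symmetric])
  then show "integral {t..b} (\<lambda>r. exp (\<mu> * (r - t))) \<le> exp (\<mu> * (b - t)) / \<mu>"
    using assms by (simp add: integral_unique)
  have "((\<lambda>r. exp (\<mu> * (b - r))) has_integral - exp (\<mu> * (b - b)) / \<mu> - - exp (\<mu> * (b - t)) / \<mu>) {t..b}"
    using assms by (intro fundamental_theorem_of_calculus)
      (auto intro!: derivative_eq_intros simp: has_real_derivative_iff_has_vector_derivative[symmetric])
  then show "integral {t..b} (\<lambda>r. exp (\<mu> * (b - r))) \<le> exp (\<mu> * (b - t)) / \<mu>"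
    using assms by (simp add: integral_unique)
qed

lemma selfadjoint_X_dualD:
  assumes "selfadjoint_X_dual scl A"
  shows "A \<in> L_X_dual scl" and "\<langle>A x, y\<rangle> = conj \<langle>A y, x\<rangle>"
  using assms unfolding selfadjoint_X_dual_def is_adjoint_X_dual_def by blast+

lemma selfadjoint_X_dualI:
  "A \<in> L_X_dual scl \<Longrightarrow> (\<And>x y. \<langle>A x, y\<rangle> = conj \<langle>A y, x\<rangle>) \<Longrightarrow> selfadjoint_X_dual scl A"
  unfolding selfadjoint_X_dual_def is_adjoint_X_dual_def by blast

lemma dual_scl_diff: "dual_scl c (y - z) = dual_scl c y - dual_scl c z"
  by (rule blinfun_eqI) (simp add: dual_scl_pairing blinfun.diff_left right_diff_distrib)

context riccati_data
begin

lemma source_operator: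
  assumes P: "opfun a b R P" "R \<ge> 0" and r: "0 \<le> a" "b \<le> T" "a \<le> r" "r \<le> b"
  shows "source P r \<in> L_X_dual scl" and "norm (source P r x) \<le> (kC + R\<^sup>2 * kB) * norm x"
proof -
  have r': "0 \<le> r" "r \<le> T" using r by auto
  note Pl = L_X_dual_simps[OF opfunD(1)[OF P(1) r(3,4)]]
  note Cl = L_X_dual_simps[OF C_op[OF r']]
  show bound: "norm (source P r x) \<le> (kC + R\<^sup>2 * kB) * norm x" for x
  proof -
    have "norm (P r (B r (P r x))) \<le> R * (kB * (R * norm x))"
      using P r r' kB_pos
      by (intro order_trans[OF opfunD(2)[OF P(1)]] mult_left_mono order_trans[OF B_bound]
          opfunD(2)[OF P(1)] Pl(1)) auto
    moreover have "norm (C r x) \<le> kC * norm x"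
      by (rule C_bound[OF r'])
    ultimately show ?thesis
      unfolding source_def by (intro order_trans[OF norm_triangle_ineq4])
        (simp add: algebra_simps power2_eq_square)
  qed
  show "source P r \<in> L_X_dual scl"
  proof (rule L_X_dualI[OF _ _ _ bound])
    show "source P r x \<in> D" for x
      unfolding source_def by (intro dual_diff Cl(1) Pl(1))
    show "source P r (x + y) = source P r x + source P r y" for x y
    proof -
      have "B r (P r x + P r y) = B r (P r x) + B r (P r y)"
        by (rule operatorsD(2)[OF B_op[OF r'] Pl(1) Pl(1)])
      then show ?thesis by (simp add: source_def Cl(2) Pl(2))
    qed
    show "source P r (scl c x) = dual_scl c (source P r x)" for c x
    proof -
      have "B r (dual_scl c (P r x)) = scl c (B r (P r x))"
        by (rule operatorsD(3)[OF B_op[OF r'] Pl(1)])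
      then show ?thesis by (simp add: source_def Cl(7) Pl(7) dual_scl_diff)
    qed
  qed
qed

lemma BP_continuous:
  assumes P: "opfun a b R P" and r: "0 \<le> a" "b \<le> T" "a \<le> a'" "b' \<le> b"
    and z: "continuous_on {a'..b'} z"
  shows "continuous_on {a'..b'} (\<lambda>r. B r (P r (z r)))"
  by (intro B_apply_continuous opfun_apply_continuous[OF P r(3,4) z]) (use r opfunD(4)[OF P] in auto)

lemma opfun_source:
  assumes P: "opfun a b R P" "R \<ge> 0" and r: "0 \<le> a" "b \<le> T"
  shows "opfun a b (kC + R\<^sup>2 * kB) (source P)"
  unfolding opfun_def
proof (intro conjI ballI allI)
  fix x
  have "continuous_on {a..b} (\<lambda>r. P r (B r (P r x)))"
    by (intro opfun_apply_continuous[OF P(1)] BP_continuous[OF P(1)] r continuous_on_const order_refl)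
  moreover have "continuous_on {a..b} (\<lambda>r. C r x)"
    by (rule continuous_on_subset[OF C_cont]) (use r in auto)
  ultimately show "continuous_on {a..b} (\<lambda>t. source P t x)"
    unfolding source_def by (intro continuous_on_diff)
qed (use source_operator[OF P r] in auto)

lemma B_swap:
  assumes "0 \<le> t" "t \<le> T" "y \<in> D" "z \<in> D"
  shows "\<langle>y, B t z\<rangle> = conj \<langle>z, B t y\<rangle>"
  using B_selfadjoint[OF assms(1,2)] assms(3,4)
  unfolding selfadjoint_dual_X_def is_adjoint_dual_X_def by blast

lemma source_selfadjoint:
  assumes P: "opfun a b R P" "R \<ge> 0" and r: "0 \<le> a" "b \<le> T" "a \<le> r" "r \<le> b"
    and sa: "selfadjoint_X_dual scl (P r)"
  shows "selfadjoint_X_dual scl (source P r)"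
proof (rule selfadjoint_X_dualI)
  show "source P r \<in> L_X_dual scl"
    by (rule source_operator[OF P r])
  fix x y
  have r': "0 \<le> r" "r \<le> T" using r by auto
  have PD: "P r z \<in> D" for z by (rule opfunD(4)[OF P(1) r(3,4)])
  have "\<langle>P r (B r (P r x)), y\<rangle> = conj \<langle>P r y, B r (P r x)\<rangle>"
    by (rule selfadjoint_X_dualD(2)[OF sa])
  also have "\<dots> = \<langle>P r x, B r (P r y)\<rangle>"
    using B_swap[OF r' PD PD, of y x] by (simp add: conj_conj)
  also have "\<dots> = conj \<langle>P r (B r (P r y)), x\<rangle>"
    by (rule selfadjoint_X_dualD(2)[OF sa])
  finally have 1: "\<langle>P r (B r (P r x)), y\<rangle> = conj \<langle>P r (B r (P r y)), x\<rangle>" .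
  have 2: "\<langle>C r x, y\<rangle> = conj \<langle>C r y, x\<rangle>"
    by (rule selfadjoint_X_dualD(2)[OF C_selfadjoint[OF r']])
  show "\<langle>source P r x, y\<rangle> = conj \<langle>source P r y, x\<rangle>"
    unfolding source_def blinfun.diff_left conj_diff by (simp only: 1[symmetric] 2[symmetric])
qed

text \<open>Splits \<open>P B P - Q B Q\<close> as \<open>(P - Q) B P + Q B (P - Q)\<close>; each
  part costs \<open>R * kB * c\<close>.\<close>

lemma source_diff_bound:
  assumes P: "opfun a b R P" and Q: "opfun a b R Q" and R: "R \<ge> 0"
    and r: "0 \<le> a" "b \<le> T" "a \<le> r" "r \<le> b"
    and c: "\<And>x. norm (P r x - Q r x) \<le> c * norm x" "c \<ge> 0"
  shows "norm (source P r x - source Q r x) \<le> 2 * R * kB * c * norm x"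
proof -
  have r': "0 \<le> r" "r \<le> T" using r by auto
  have PD: "P r z \<in> D" "Q r z \<in> D" for z
    using opfunD(4)[OF P r(3,4)] opfunD(4)[OF Q r(3,4)] by auto
  have "norm (P r (B r (P r x)) - Q r (B r (P r x))) \<le> c * (kB * (R * norm x))"
    using c(2) kB_pos by (intro order_trans[OF c(1)] mult_left_mono order_trans[OF B_bound[OF r' PD(1)]]
        opfunD(2)[OF P r(3,4)]) auto
  moreover have "norm (Q r (B r (P r x)) - Q r (B r (Q r x))) \<le> R * (kB * (c * norm x))"
    using R kB_pos by (intro order_trans[OF opfunD(5)[OF Q r(3,4)]] mult_left_mono
        order_trans[OF B_bound_diff[OF r' PD]] c) auto
  moreover have "source P r x - source Q r x
      = - ((P r (B r (P r x)) - Q r (B r (P r x))) + (Q r (B r (P r x)) - Q r (B r (Q r x))))"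
    by (simp add: source_def)
  ultimately show ?thesis
    using norm_triangle_ineq[of "P r (B r (P r x)) - Q r (B r (P r x))" "Q r (B r (P r x)) - Q r (B r (Q r x))"]
    by (simp only: norm_minus_cancel) (simp add: algebra_simps)
qed

text \<open>The terminal terms cancel, and \<open>M\<^sup>2\<close> comes from the factors
  \<open>U\<close> and \<open>V\<close>. The bound \<open>g\<close> may vary with \<open>r\<close>:
  a constant serves Picard iteration, an exponential serves uniqueness.\<close>

lemma Lam_diff_bound:
  assumes K: "opfun a b R K" "opfun a b R K'" and ab: "0 \<le> a" "b \<le> T" and t: "a \<le> t" "t \<le> b"
    and g: "continuous_on {t..b} g" "\<And>r x. t \<le> r \<Longrightarrow> r \<le> b \<Longrightarrow> norm (K r x - K' r x) \<le> g r * norm x"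
      "\<And>r. t \<le> r \<Longrightarrow> r \<le> b \<Longrightarrow> g r \<ge> 0"
  shows "norm (Lam b H K t x - Lam b H K' t x) \<le> M\<^sup>2 * integral {t..b} g * norm x"
proof -
  note int = VKU_integrable[OF K(1) ab t] VKU_integrable[OF K(2) ab t]
  have "Lam b H K t x - Lam b H K' t x
      = integral {t..b} (\<lambda>r. V t r (K r (U r t x)) - V t r (K' r (U r t x)))"
    by (simp add: Lam_def integral_diff[OF int])
  also have "norm \<dots> \<le> integral {t..b} (\<lambda>r. M * (g r * (M * norm x)))"
  proof (rule integral_norm_bound_integral)
    show "(\<lambda>r. M * (g r * (M * norm x))) integrable_on {t..b}"
      by (intro integrable_continuous_real continuous_intros g)
    fix r assume "r \<in> {t..b}"
    then have r: "0 \<le> t" "t \<le> r" "r \<le> T" "r \<le> b" "a \<le> r" using t ab by auto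
    show "norm (V t r (K r (U r t x)) - V t r (K' r (U r t x))) \<le> M * (g r * (M * norm x))"
      using r M_pos g(3) by (intro order_trans[OF V_bound_diff] opfunD(4)[OF K(1)] opfunD(4)[OF K(2)]
          mult_left_mono order_trans[OF g(2)] U_bound) auto
  qed (intro integrable_diff int)
  also have "\<dots> = integral {t..b} (\<lambda>r. (M\<^sup>2 * norm x) * g r)"
    by (simp add: power2_eq_square mult_ac)
  also have "\<dots> = M\<^sup>2 * integral {t..b} g * norm x"
    by simp
  finally show ?thesis .
qed

lemma Lam_cong:
  assumes "\<And>r. t \<le> r \<Longrightarrow> r \<le> b \<Longrightarrow> K r = K' r"
  shows "Lam b H K t x = Lam b H K' t x"
  unfolding Lam_def using assms by (intro arg_cong2[where f = "(+)"] refl integral_cong) auto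

lemma Lam_terminal:
  assumes "0 \<le> b" "b \<le> T" "H x \<in> D"
  shows "Lam b H K b x = H x"
proof -
  have "V b b (H x) = H x"
    by (rule blinfun_eqI) (simp add: V_pairing U_refl assms)
  then show ?thesis by (simp add: Lam_def U_refl assms)
qed

text \<open>Completeness of the ball for operator-norm convergence uniform in time. Linearity and
  the bound pass to pointwise limits, and the values stay in the dual space because it is
  closed.\<close>

lemma opfun_uniform_limit:
  assumes P: "\<And>n. opfun a b R (P n)"
    and lim: "\<And>e. e > 0 \<Longrightarrow> \<exists>N. \<forall>n\<ge>N. \<forall>t\<in>{a..b}. \<forall>x. norm (P n t x - Q t x) \<le> e * norm x"
  shows "opfun a b R Q" and "a \<le> t \<Longrightarrow> t \<le> b \<Longrightarrow> (\<lambda>n. P n t x) \<longlonglongrightarrow> Q t x"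
proof -
  have tends: "(\<lambda>n. P n t x) \<longlonglongrightarrow> Q t x" if "a \<le> t" "t \<le> b" for t x
  proof (rule metric_LIMSEQ_I)
    fix e :: real assume "e > 0"
    define e' where "e' = e / (norm x + 1)"
    have pos: "norm x + 1 > 0"
      using norm_ge_zero[of x] by linarith
    then have "e' > 0" using \<open>e > 0\<close> by (simp add: e'_def)
    from lim[OF this] obtain N where N: "\<forall>n\<ge>N. \<forall>t\<in>{a..b}. \<forall>x. norm (P n t x - Q t x) \<le> e' * norm x" ..
    have "e' * norm x < e' * (norm x + 1)"
      using \<open>e' > 0\<close> by (intro mult_strict_left_mono) auto
    also have "\<dots> = e" using pos by (simp add: e'_def)
    finally have "e' * norm x < e" .
    then have "\<forall>n\<ge>N. dist (P n t x) (Q t x) < e"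
      using N that unfolding dist_norm by (meson atLeastAtMost_iff order_le_less_trans)
    then show "\<exists>N. \<forall>n\<ge>N. dist (P n t x) (Q t x) < e" ..
  qed
  then show "a \<le> t \<Longrightarrow> t \<le> b \<Longrightarrow> (\<lambda>n. P n t x) \<longlonglongrightarrow> Q t x" .
  show "opfun a b R Q"
    unfolding opfun_def
  proof (intro conjI ballI allI)
    fix t assume "t \<in> {a..b}"
    then have t: "a \<le> t" "t \<le> b" by auto
    note Pl = L_X_dual_simps[OF opfunD(1)[OF P t]]
    show bound: "norm (Q t x) \<le> R * norm x" for x
      by (rule LIMSEQ_le_const2[OF tendsto_norm[OF tends[OF t]]]) (use opfunD(2)[OF P t] in blast)
    show "Q t \<in> L_X_dual scl"
    proof (rule L_X_dualI[OF _ _ _ bound])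
      show "Q t x \<in> D" for x
        by (rule closed_sequentially[OF closed_dual _ tends[OF t]]) (rule Pl(1))
      show "Q t (x + y) = Q t x + Q t y" for x y
        using tendsto_add[OF tends[OF t, of x] tends[OF t, of y]] LIMSEQ_unique[OF tends[OF t, of "x + y"]]
        by (simp add: Pl(2))
      show "Q t (scl c x) = dual_scl c (Q t x)" for c x
      proof -
        have "(\<lambda>n. dual_scl c (P n t x)) \<longlonglongrightarrow> dual_scl c (Q t x)"
          unfolding dual_scl_def by (intro tendsto_intros tends t)
        then show ?thesis
          using LIMSEQ_unique[OF tends[OF t, of "scl c x"]] by (simp add: Pl(7))
      qed
    qed
  next
    fix x
    show "continuous_on {a..b} (\<lambda>t. Q t x)"
    proof (rule continuous_on_locally_approximable)
      fix t0 e :: real assume "e > 0"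
      define e' where "e' = e / (norm x + 1)"
      have pos: "norm x + 1 > 0"
        using norm_ge_zero[of x] by linarith
      then have "e' > 0" using \<open>e > 0\<close> by (simp add: e'_def)
      from lim[OF this] obtain N where N: "\<forall>n\<ge>N. \<forall>t\<in>{a..b}. \<forall>x. norm (P n t x - Q t x) \<le> e' * norm x" ..
      have "e' * norm x \<le> e' * (norm x + 1)"
        using \<open>e' > 0\<close> by (intro mult_left_mono) auto
      also have "\<dots> = e" using pos by (simp add: e'_def)
      finally have "norm (Q t x - P N t x) \<le> e" if "t \<in> {a..b}" for t
        using N that norm_minus_commute[of "Q t x" "P N t x"] by (metis order_refl order_trans)
      moreover have "continuous_on ({a..b} \<inter> ball t0 1) (\<lambda>t. P N t x)"
        by (rule continuous_on_subset[OF opfunD(3)[OF P]]) auto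
      ultimately show "\<exists>\<delta>>0. \<exists>g. continuous_on ({a..b} \<inter> ball t0 \<delta>) g \<and>
          (\<forall>t\<in>{a..b} \<inter> ball t0 \<delta>. norm (Q t x - g t) \<le> e)"
        using zero_less_one by blast
    qed
  qed
qed

definition sol :: "real \<Rightarrow> real \<Rightarrow> real \<Rightarrow> ('a \<Rightarrow> ('a \<Rightarrow>\<^sub>L 'k)) \<Rightarrow> (real \<Rightarrow> 'a \<Rightarrow> ('a \<Rightarrow>\<^sub>L 'k)) \<Rightarrow> bool"
  where "sol a b R H P \<longleftrightarrow> opfun a b R P \<and> (\<forall>t\<in>{a..b}. \<forall>x. P t x = Lam b H (source P) t x)"

lemma local_solution:
  assumes \<beta>: "\<beta> > 0"
  obtains h R where "h > 0" "R > 0"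
    "\<And>a b H. 0 \<le> a \<Longrightarrow> b \<le> T \<Longrightarrow> b - a \<le> h \<Longrightarrow> selfadjoint_X_dual scl H \<Longrightarrow>
      (\<And>x. norm (H x) \<le> \<beta> * norm x) \<Longrightarrow>
      \<exists>P. sol a b R H P \<and> (\<forall>t\<in>{a..b}. selfadjoint_X_dual scl (P t))"
proof -
  \<comment> \<open>The terminal term contributes at most \<open>M\<^sup>2 * \<beta>\<close>; the
    remaining 1 is left to the integral.\<close>
  define R where "R = M\<^sup>2 * \<beta> + 1"
  have R: "R > 0" using \<beta> by (simp add: R_def add_nonneg_pos)
  define k where "k = kC + R\<^sup>2 * kB"
  have k: "k > 0" using kC_pos kB_pos by (simp add: k_def add_pos_nonneg)
  \<comment> \<open>As \<open>k\<close> bounds the source, the first entry keeps the iterates in the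
    ball of radius \<open>R\<close>. The second makes the Lipschitz constant
    \<open>2 * M\<^sup>2 * R * kB * h\<close> at most 1/2.\<close>
  define h where "h = min (1 / (M\<^sup>2 * k)) (1 / (4 * M\<^sup>2 * R * kB))"
  have h: "h > 0" "M\<^sup>2 * k * h \<le> 1" "4 * M\<^sup>2 * R * kB * h \<le> 1"
    using M_pos k kB_pos R by (auto simp: h_def min_def field_simps)
  have "\<exists>P. sol a b R H P \<and> (\<forall>t\<in>{a..b}. selfadjoint_X_dual scl (P t))"
    if ab: "0 \<le> a" "b \<le> T" and len: "b - a \<le> h" and H: "selfadjoint_X_dual scl H"
      "\<And>x. norm (H x) \<le> \<beta> * norm x" for a b H
  proof -
    note Hop = selfadjoint_X_dualD(1)[OF H(1)]
    \<comment> \<open>Self-adjointness is part of the invariant set, so the fixed point inherits it.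
      Functions are uncurried so that the index contains the vector whose norm is the
      weight.\<close>
    define S where "S = {f :: real \<times> 'a \<Rightarrow> ('a \<Rightarrow>\<^sub>L 'k). opfun a b R (curry f) \<and>
      (\<forall>t\<in>{a..b}. selfadjoint_X_dual scl (curry f t))}"
    define F where "F f = (\<lambda>(t, x). Lam b H (source (curry f)) t x)"
      for f :: "real \<times> 'a \<Rightarrow> ('a \<Rightarrow>\<^sub>L 'k)"
    have src: "opfun a b k (source (curry f))" if "f \<in> S" for f
      using that R ab unfolding S_def k_def by (intro opfun_source) auto
    have FS: "F f \<in> S" if "f \<in> S" for f
    proof -
      note K = src[OF that]
      have cF: "curry (F f) = Lam b H (source (curry f))"
        by (auto simp: F_def)
      have "opfun a b R (Lam b H (source (curry f)))"
        unfolding opfun_def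
      proof (intro conjI ballI allI)
        fix t assume "t \<in> {a..b}"
        then have t: "a \<le> t" "t \<le> b" by auto
        show "Lam b H (source (curry f)) t \<in> L_X_dual scl"
          by (rule Lam_operator[OF K ab Hop H(2)]) (use \<beta> k t in auto)
        fix x
        have "norm (Lam b H (source (curry f)) t x) \<le> M\<^sup>2 * (\<beta> + k * (b - t)) * norm x"
          by (rule Lam_bound[OF K ab L_X_dual_simps(1)[OF Hop] H(2)]) (use \<beta> k t in auto)
        also have "M\<^sup>2 * (\<beta> + k * (b - t)) \<le> M\<^sup>2 * (\<beta> + k * h)"
          using len t k by (intro mult_left_mono add_left_mono) auto
        also have "\<dots> \<le> R"
          using h(2) by (simp add: R_def algebra_simps)
        finally show "norm (Lam b H (source (curry f)) t x) \<le> R * norm x"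
          by (simp add: mult_right_mono)
      next
        show "continuous_on {a..b} (\<lambda>t. Lam b H (source (curry f)) t x)" for x
          by (rule Lam_continuous[OF K ab Hop H(2)]) (use \<beta> k in auto)
      qed
      moreover have "selfadjoint_X_dual scl (Lam b H (source (curry f)) t)" if t: "t \<in> {a..b}" for t
      proof (rule Lam_selfadjoint[OF K ab H])
        show "selfadjoint_X_dual scl (source (curry f) r)" if "a \<le> r" "r \<le> b" for r
          by (rule source_selfadjoint[of a b R]) (use \<open>f \<in> S\<close> R ab that in \<open>auto simp: S_def\<close>)
      qed (use \<beta> k t in auto)
      ultimately show ?thesis
        unfolding S_def cF mem_Collect_eq by blast
    qed
    have zero: "(\<lambda>_. 0) \<in> S"
    proof -
      have "(\<lambda>_. 0) \<in> L_X_dual scl"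
        by (rule L_X_dualI[of _ 0])
          (auto intro: real_vector.subspace_0[OF subspace_dual] blinfun_eqI simp: dual_scl_pairing)
      then show ?thesis
        using R by (auto simp: S_def opfun_def curry_def conj_zero intro!: selfadjoint_X_dualI)
    qed
    obtain f where f: "f \<in> S" "\<And>i. i \<in> {a..b} \<times> UNIV \<Longrightarrow> F f i = f i"
    proof (rule weighted_contraction_fixpoint[where F = F and S = S and I = "{a..b} \<times> UNIV"
          and w = "norm \<circ> snd" and d = R and ?f0.0 = "\<lambda>_. 0"])
      fix i :: "real \<times> 'a" assume "i \<in> {a..b} \<times> UNIV"
      then show "norm (F (\<lambda>_. 0) i - 0) \<le> R * (norm \<circ> snd) i"
        using FS[OF zero] by (auto simp: S_def opfun_def curry_def)
    next
      fix f g c and i :: "real \<times> 'a"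
      assume fg: "f \<in> S" "g \<in> S" and c: "c > 0" and i: "i \<in> {a..b} \<times> UNIV"
        and d: "\<And>j. j \<in> {a..b} \<times> UNIV \<Longrightarrow> norm (f j - g j) \<le> c * (norm \<circ> snd) j"
      obtain t x where ix: "i = (t, x)" and t: "a \<le> t" "t \<le> b" using i by auto
      have "norm (Lam b H (source (curry f)) t x - Lam b H (source (curry g)) t x)
          \<le> M\<^sup>2 * integral {t..b} (\<lambda>_. 2 * R * kB * c) * norm x"
      proof (rule Lam_diff_bound[OF src[OF fg(1)] src[OF fg(2)] ab t])
        fix r x assume r: "t \<le> r" "r \<le> b"
        show "norm (source (curry f) r x - source (curry g) r x) \<le> 2 * R * kB * c * norm x"
        proof (rule source_diff_bound[of a b])
          show "norm (curry f r x - curry g r x) \<le> c * norm x" for x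
            using d[of "(r, x)"] r t by simp
        qed (use fg R c r t ab in \<open>auto simp: S_def\<close>)
      qed (use R c kB_pos in auto)
      also have "\<dots> = (4 * M\<^sup>2 * R * kB * (b - t)) * (c / 2 * norm x)"
        using t by simp
      also have "\<dots> \<le> 1 * (c / 2 * norm x)"
      proof (rule mult_right_mono)
        have "4 * M\<^sup>2 * R * kB * (b - t) \<le> 4 * M\<^sup>2 * R * kB * h"
          using len t R kB_pos by (intro mult_left_mono) auto
        then show "4 * M\<^sup>2 * R * kB * (b - t) \<le> 1"
          using h(3) by linarith
      qed (use c in auto)
      finally show "norm (F f i - F g i) \<le> c / 2 * (norm \<circ> snd) i"
        by (simp add: ix F_def)
    next
      fix f and s :: "nat \<Rightarrow> real \<times> 'a \<Rightarrow> ('a \<Rightarrow>\<^sub>L 'k)"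
      assume s: "\<And>n. s n \<in> S"
        and lim: "\<And>e. e > 0 \<Longrightarrow> \<exists>N. \<forall>n\<ge>N. \<forall>i\<in>{a..b} \<times> UNIV. norm (s n i - f i) \<le> e * (norm \<circ> snd) i"
      have s': "opfun a b R (curry (s n))" for n
        using s[of n] by (simp add: S_def)
      have lim': "\<exists>N. \<forall>n\<ge>N. \<forall>t\<in>{a..b}. \<forall>x. norm (curry (s n) t x - curry f t x) \<le> e * norm x" if "e > 0" for e
        using lim[OF that] by fastforce
      note limf = opfun_uniform_limit[OF s' lim']
      have "selfadjoint_X_dual scl (curry f t)" if "t \<in> {a..b}" for t
      proof (rule selfadjoint_X_dualI)
        have t: "a \<le> t" "t \<le> b" using that by auto
        show "curry f t \<in> L_X_dual scl" by (rule opfunD(1)[OF limf(1) t])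
        fix x y
        have "(\<lambda>n. \<langle>curry (s n) t x, y\<rangle>) \<longlonglongrightarrow> \<langle>curry f t x, y\<rangle>"
          by (intro tendsto_intros limf(2) t)
        moreover have "(\<lambda>n. conj \<langle>curry (s n) t y, x\<rangle>) \<longlonglongrightarrow> conj \<langle>curry f t y, x\<rangle>"
          by (intro bounded_linear.tendsto[OF bounded_linear_conj] tendsto_intros limf(2) t)
        moreover have "\<langle>curry (s n) t x, y\<rangle> = conj \<langle>curry (s n) t y, x\<rangle>" for n
          using s[of n] that unfolding S_def by (intro selfadjoint_X_dualD(2)[of scl]) blast
        ultimately show "\<langle>curry f t x, y\<rangle> = conj \<langle>curry f t y, x\<rangle>"
          using LIMSEQ_unique by (metis (no_types, lifting) ext)
      qed
      then show "f \<in> S" using limf(1) unfolding S_def by blast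
    qed (use zero FS R in auto)
    have "sol a b R H (curry f)"
      unfolding sol_def using f(1) f(2) by (auto simp: S_def F_def)
    then show ?thesis using f(1) by (auto simp: S_def)
  qed
  then show thesis using that[OF h(1) R] by blast
qed

text \<open>Above \<open>s\<close> nothing changes, since \<open>Lam\<close> at \<open>r\<close>
  sees only values from \<open>r\<close> on. Below \<open>s\<close>, the flow identity turns the
  equation with terminal time \<open>b\<close> into the one with terminal operator
  \<open>P1 s\<close> at time \<open>s\<close>, which \<open>P2\<close> solves.\<close>

lemma sol_glue:
  assumes P1: "sol s b R H P1" and P2: "sol a s R' (P1 s) P2" and R: "R \<ge> 0" "R' \<ge> 0"
    and H: "\<And>x. H x \<in> D" and t: "0 \<le> a" "a \<le> s" "s \<le> b" "b \<le> T"
  shows "sol a b (max R R') H (\<lambda>t. if t \<le> s then P2 t else P1 t)"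
proof -
  define P where "P t = (if t \<le> s then P2 t else P1 t)" for t
  note o1 = P1[unfolded sol_def, THEN conjunct1] and o2 = P2[unfolded sol_def, THEN conjunct1]
  have e1: "P1 t x = Lam b H (source P1) t x" if "s \<le> t" "t \<le> b" for t x
    using P1 that by (simp add: sol_def)
  have e2: "P2 t x = Lam s (P1 s) (source P2) t x" if "a \<le> t" "t \<le> s" for t x
    using P2 that by (simp add: sol_def)
  have P1D: "P1 s x \<in> D" for x
    by (rule opfunD(4)[OF o1]) (use t in auto)
  \<comment> \<open>At the end point the integral vanishes and \<open>V s s\<close> is the identity
    on the dual space, so the two pieces meet continuously.\<close>
  have s: "P2 s = P1 s"
  proof
    show "P2 s x = P1 s x" for x
      using t Lam_terminal[of s "P1 s" x "source P2"] P1D by (simp add: e2)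
  qed
  have PP: "P r = P1 r" if "s \<le> r" for r
    using that s by (auto simp: P_def)
  have PP': "P r = P2 r" if "r \<le> s" for r
    using that by (simp add: P_def)
  have oP: "opfun a b (max R R') P"
    unfolding opfun_def
  proof (intro conjI ballI allI)
    fix r assume r: "r \<in> {a..b}"
    then show "P r \<in> L_X_dual scl"
      using opfunD(1)[OF o1, of r] opfunD(1)[OF o2, of r] by (auto simp: P_def)
    fix x
    have "norm (P r x) \<le> R * norm x \<or> norm (P r x) \<le> R' * norm x"
      using opfunD(2)[OF o1, of r x] opfunD(2)[OF o2, of r x] r by (auto simp: P_def)
    moreover have "R * norm x \<le> max R R' * norm x" "R' * norm x \<le> max R R' * norm x"
      by (auto intro: mult_right_mono)
    ultimately show "norm (P r x) \<le> max R R' * norm x"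
      by linarith
  next
    fix x
    have "continuous_on ({a..s} \<union> {s..b}) (\<lambda>r. if r \<le> s then P2 r x else P1 r x)"
      by (rule continuous_on_If) (use opfunD(3)[OF o1] opfunD(3)[OF o2] s in auto)
    then show "continuous_on {a..b} (\<lambda>r. P r x)"
      using t by (simp add: P_def if_distrib[of "\<lambda>f. f x"] ivl_disj_un_two_touch)
  qed
  have src: "opfun a b (kC + (max R R')\<^sup>2 * kB) (source P)"
    by (rule opfun_source[OF oP]) (use R t in auto)
  have sP1: "source P r = source P1 r" if "s \<le> r" for r
    using PP[OF that] by (simp add: source_def fun_eq_iff)
  have sP2: "source P r = source P2 r" if "r \<le> s" for r
    using PP'[OF that] by (simp add: source_def fun_eq_iff)
  have up: "P r x = Lam b H (source P) r x" if "s \<le> r" "r \<le> b" for r x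
    unfolding PP[OF that(1)] e1[OF that] by (rule Lam_cong) (use that sP1 in auto)
  have "P r x = Lam b H (source P) r x" if r: "a \<le> r" "r \<le> s" for r x
  proof -
    have L: "Lam b H (source P) s = P1 s"
    proof
      show "Lam b H (source P) s x = P1 s x" for x
        using up[OF order_refl t(3), of x] PP[OF order_refl] by simp
    qed
    have "Lam b H (source P) r x = V r s (Lam b H (source P) s (U s r x))
        + integral {r..s} (\<lambda>q. V r q (source P q (U q r x)))"
      by (rule Lam_flow[OF src t(1,4) H _ r t(3)]) (simp add: L P1D)
    also have "\<dots> = Lam s (P1 s) (source P) r x"
      by (simp only: L Lam_def)
    also have "\<dots> = Lam s (P1 s) (source P2) r x"
      by (rule Lam_cong) (rule sP2)
    finally show ?thesis using e2[OF r] r by (simp add: PP')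
  qed
  then have "P r x = Lam b H (source P) r x" if "a \<le> r" "r \<le> b" for r x
    using up[of r x] that by (cases "r \<le> s") auto
  then have "sol a b (max R R') H P"
    unfolding sol_def using oP by auto
  then show ?thesis unfolding P_def .
qed

lemma sol_eq:
  "sol a b R H P \<Longrightarrow> a \<le> t \<Longrightarrow> t \<le> b \<Longrightarrow> P t x = Lam b H (source P) t x"
  unfolding sol_def by auto

lemma sol_unique:
  assumes P: "sol a b R H P" and Q: "sol a b R H Q" and R: "R > 0" and ab: "0 \<le> a" "b \<le> T"
    and t: "a \<le> t" "t \<le> b"
  shows "P t x = Q t x"
proof -
  \<comment> \<open>The difference of the right-hand sides costs
    \<open>2 * M\<^sup>2 * R * kB\<close> and the weighted integral returns
    \<open>1 / \<mu>\<close>, so each use of the equation halves the constant.\<close>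
  define \<mu> where "\<mu> = 4 * M\<^sup>2 * R * kB"
  have \<mu>: "\<mu> > 0" using M_pos R kB_pos by (simp add: \<mu>_def)
  have R': "R \<ge> 0" using R by simp
  note oP = P[unfolded sol_def, THEN conjunct1] and oQ = Q[unfolded sol_def, THEN conjunct1]
  have step: "norm (P t x - Q t x) \<le> c / 2 * exp (\<mu> * (b - t)) * norm x"
    if c: "\<And>t x. a \<le> t \<Longrightarrow> t \<le> b \<Longrightarrow> norm (P t x - Q t x) \<le> c * exp (\<mu> * (b - t)) * norm x"
      "c \<ge> 0" and t: "a \<le> t" "t \<le> b" for c t x
  proof -
    have "norm (P t x - Q t x) = norm (Lam b H (source P) t x - Lam b H (source Q) t x)"
      by (simp only: sol_eq[OF P t, of x] sol_eq[OF Q t, of x])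
    also have "\<dots> \<le> M\<^sup>2 * integral {t..b} (\<lambda>r. 2 * R * kB * (c * exp (\<mu> * (b - r)))) * norm x"
    proof (rule Lam_diff_bound[OF opfun_source[OF oP R' ab] opfun_source[OF oQ R' ab] ab t])
      show "continuous_on {t..b} (\<lambda>r. 2 * R * kB * (c * exp (\<mu> * (b - r))))"
        by (intro continuous_intros)
      fix r assume r: "t \<le> r" "r \<le> b"
      show "norm (source P r x - source Q r x) \<le> 2 * R * kB * (c * exp (\<mu> * (b - r))) * norm x" for x
      proof (rule source_diff_bound[OF oP oQ R' ab _ r(2)])
        show "a \<le> r" using r t by simp
        show "norm (P r x - Q r x) \<le> c * exp (\<mu> * (b - r)) * norm x" for x
          by (rule c(1)) (use r t in auto)
        show "0 \<le> c * exp (\<mu> * (b - r))" using c(2) by simp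
      qed
      show "0 \<le> 2 * R * kB * (c * exp (\<mu> * (b - r)))"
        using R kB_pos c(2) by (intro mult_nonneg_nonneg) auto
    qed
    also have "\<dots> = (\<mu> * (c / 2) * norm x) * integral {t..b} (\<lambda>r. exp (\<mu> * (b - r)))"
    proof -
      define J where "J = integral {t..b} (\<lambda>r. exp (\<mu> * (b - r)))"
      have "integral {t..b} (\<lambda>r. 2 * R * kB * (c * exp (\<mu> * (b - r)))) = 2 * R * kB * c * J"
        unfolding J_def mult.assoc[symmetric] by (rule integral_mult_right)
      moreover have "M\<^sup>2 * (2 * R * kB * c * J) * norm x = \<mu> * (c / 2) * norm x * J"
        unfolding \<mu>_def by algebra
      ultimately show ?thesis
        unfolding J_def[symmetric] by (simp only:)
    qed
    also have "\<dots> \<le> (\<mu> * (c / 2) * norm x) * (exp (\<mu> * (b - t)) / \<mu>)"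
      using \<mu> c(2) by (intro mult_left_mono integral_exp_le(2)[OF \<mu> t(2)] mult_nonneg_nonneg) auto
    also have "\<dots> = c / 2 * exp (\<mu> * (b - t)) * norm x"
      using \<mu> by simp
    finally show ?thesis .
  qed
  have bound: "a \<le> t \<Longrightarrow> t \<le> b \<Longrightarrow> norm (P t x - Q t x) \<le> 2 * R / 2 ^ n * exp (\<mu> * (b - t)) * norm x"
    for n t x
  proof (induction n arbitrary: t x)
    case 0
    \<comment> \<open>Both functions lie in the ball and the weight is at least 1, so the induction
      starts from \<open>2 * R\<close>.\<close>
    have "norm (P t x - Q t x) \<le> R * norm x + R * norm x"
      using norm_triangle_ineq4[of "P t x" "Q t x"] opfunD(2)[OF oP 0, of x] opfunD(2)[OF oQ 0, of x]
      by linarith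
    also have "\<dots> = 2 * R * 1 * norm x" by simp
    also have "\<dots> \<le> 2 * R * exp (\<mu> * (b - t)) * norm x"
      using R \<mu> 0 by (intro mult_right_mono mult_left_mono) auto
    finally show ?case by simp
  next
    case (Suc n)
    then show ?case
      using step[OF Suc.IH, of t x] R by simp
  qed
  have "(\<lambda>n. 2 * R / 2 ^ n) \<longlonglongrightarrow> 0" by real_asymp
  from tendsto_mult[OF this tendsto_const[of "exp (\<mu> * (b - t)) * norm x"]]
  have "(\<lambda>n. 2 * R / 2 ^ n * exp (\<mu> * (b - t)) * norm x) \<longlonglongrightarrow> 0"
    by (simp add: mult.assoc)
  then have "norm (P t x - Q t x) \<le> 0"
    by (rule LIMSEQ_le_const) (use bound[OF t] in blast)
  then show ?thesis by simp
qed

end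

section \<open>Nonnegativity\<close>

text \<open>The integrand depends on the upper limit \<open>s\<close> too, so this is not an
  instance of the fundamental theorem of calculus. Closeness to \<open>L\<close> on the triangle
  \<open>r \<le> q \<le> s\<close> near \<open>r\<close> replaces continuity at
  \<open>r\<close>.\<close>

lemma tendsto_average_at_right:
  fixes f :: "real \<Rightarrow> real \<Rightarrow> 'b::banach"
  assumes "r < b" and cont: "\<And>s. r < s \<Longrightarrow> s \<le> b \<Longrightarrow> continuous_on {r..s} (f s)"
    and lim: "\<And>e. e > 0 \<Longrightarrow> \<exists>\<delta>>0. \<forall>s q. r \<le> q \<longrightarrow> q \<le> s \<longrightarrow> s < r + \<delta> \<longrightarrow> s \<le> b \<longrightarrow> norm (f s q - L) \<le> e"
  shows "((\<lambda>s. (1 / (s - r)) *\<^sub>R integral {r..s} (f s)) \<longlongrightarrow> L) (at_right r)"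
proof (rule tendstoI)
  fix e :: real assume "e > 0"
  then obtain \<delta> where \<delta>: "\<delta> > 0"
    and close: "\<And>s q. r \<le> q \<Longrightarrow> q \<le> s \<Longrightarrow> s < r + \<delta> \<Longrightarrow> s \<le> b \<Longrightarrow> norm (f s q - L) \<le> e / 2"
    using lim[of "e / 2"] by auto
  have "eventually (\<lambda>s. s \<in> {r<..<min b (r + \<delta>)}) (at_right r)"
    using \<open>r < b\<close> \<delta> by (intro eventually_at_right_real) auto
  then show "eventually (\<lambda>s. dist ((1 / (s - r)) *\<^sub>R integral {r..s} (f s)) L < e) (at_right r)"
  proof (rule eventually_mono)
    fix s assume "s \<in> {r<..<min b (r + \<delta>)}"
    then have s: "r < s" "s \<le> b" "s < r + \<delta>" by auto
    have "norm (integral {r..s} (\<lambda>q. f s q - L)) \<le> e / 2 * (s - r)"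
      using s by (intro integral_bound continuous_on_diff cont continuous_on_const close) auto
    moreover have "integral {r..s} (\<lambda>q. f s q - L) = integral {r..s} (f s) - (s - r) *\<^sub>R L"
      using s by (subst integral_diff) (auto intro!: integrable_continuous_real cont)
    moreover have "(1 / (s - r)) *\<^sub>R integral {r..s} (f s) - L
        = (1 / (s - r)) *\<^sub>R (integral {r..s} (f s) - (s - r) *\<^sub>R L)"
      using s by (simp add: scaleR_diff_right)
    ultimately have "norm ((1 / (s - r)) *\<^sub>R integral {r..s} (f s) - L) \<le> e / 2"
      using s by (simp add: pos_divide_le_eq)
    then show "dist ((1 / (s - r)) *\<^sub>R integral {r..s} (f s)) L < e"
      using \<open>e > 0\<close> by (simp add: dist_norm)
  qed
qed

lemma continuous_on_Icc_left_end:
  fixes f :: "real \<Rightarrow> 'b::real_normed_vector"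
  assumes "continuous_on {r..b} f" "r < b" "e > 0"
  obtains \<delta> where "\<delta> > 0" "\<And>s. r \<le> s \<Longrightarrow> s < r + \<delta> \<Longrightarrow> s \<le> b \<Longrightarrow> norm (f s - f r) \<le> e"
proof -
  have "r \<in> {r..b}" using assms by simp
  then obtain \<delta> where "\<delta> > 0" "\<forall>s\<in>{r..b}. dist s r < \<delta> \<longrightarrow> dist (f s) (f r) < e"
    using assms unfolding continuous_on_iff by blast
  then show thesis
    using that[of \<delta>] by (force simp: dist_norm)
qed

context riccati_data
begin

section \<open>Mild trajectories of the closed loop\<close>

lemma U_bounded_linear:
  assumes "0 \<le> s" "s \<le> t" "t \<le> T"
  shows "bounded_linear (U t s)"
proof (rule bounded_linear_intro[of _ M])
  show "norm (U t s x) \<le> norm x * M" for x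
    using U_bound[OF assms] by (simp add: mult.commute)
qed (auto intro: linear_add linear_scale U_linear[OF assms])

context
  fixes t b :: real and u :: "real \<Rightarrow> 'a"
  assumes tb: "0 \<le> t" "b \<le> T" and u: "continuous_on {t..b} u"
begin

lemma Uu_continuous:
  assumes "t \<le> s" "s \<le> r" "r \<le> b"
  shows "continuous_on {s..r} (\<lambda>q. U r q (u q))"
proof (rule continuous_on_strong_apply[where A = "\<lambda>q. U r q" and f = u and D = UNIV and M = M])
  show "continuous_on {s..r} u"
    by (rule continuous_on_subset[OF u]) (use assms in auto)
  show "continuous_on {s..r} (\<lambda>q. U r q y)" for y
    by (rule continuous_on_subset[OF U_cont2]) (use assms tb in auto)
  show "norm (U r q y - U r q z) \<le> M * norm (y - z)" if "q \<in> {s..r}" for q y z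
    by (rule U_bound_diff) (use that assms tb in auto)
qed auto

text \<open>\<open>U r s\<close> goes under the integral, where the evolution law absorbs it; this
  lets the mild equation restart at \<open>s\<close>.\<close>

lemma duhamel_flow:
  assumes "t \<le> s" "s \<le> r" "r \<le> b"
  shows "integral {t..r} (\<lambda>q. U r q (u q))
    = U r s (integral {t..s} (\<lambda>q. U s q (u q))) + integral {s..r} (\<lambda>q. U r q (u q))"
proof -
  have "(\<lambda>q. U s q (u q)) integrable_on {t..s}"
    by (intro integrable_continuous_real Uu_continuous) (use assms in auto)
  moreover have "bounded_linear (U r s)"
    using assms tb by (intro U_bounded_linear) auto
  ultimately have "U r s (integral {t..s} (\<lambda>q. U s q (u q))) = integral {t..s} (\<lambda>q. U r s (U s q (u q)))"
    by (subst integral_linear[symmetric]) (auto simp: o_def)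
  also have "\<dots> = integral {t..s} (\<lambda>q. U r q (u q))"
    using assms tb by (intro integral_cong U_trans) auto
  finally have 1: "U r s (integral {t..s} (\<lambda>q. U s q (u q))) = integral {t..s} (\<lambda>q. U r q (u q))" .
  have "(\<lambda>q. U r q (u q)) integrable_on {t..r}"
    by (intro integrable_continuous_real Uu_continuous) (use assms in auto)
  then show ?thesis
    unfolding 1
    by (intro Henstock_Kurzweil_Integration.integral_combine[symmetric] assms(1,2))
qed

text \<open>The forward counterpart of the argument for \<open>Lam\<close>: with a fixed
  \<open>s\<close> at or slightly below \<open>r0\<close>, the continuous function
  \<open>U r s J\<close> of \<open>r\<close> misses only the integral over
  \<open>{s..r}\<close>.\<close>

lemma duhamel_continuous: "continuous_on {t..b} (\<lambda>r. integral {t..r} (\<lambda>q. U r q (u q)))"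
proof (rule continuous_on_locally_approximable)
  fix r0 e :: real assume r0: "r0 \<in> {t..b}" and "e > 0"
  obtain k where k: "k > 0" "\<And>q. q \<in> {t..b} \<Longrightarrow> norm (u q) \<le> k"
    using compact_imp_bounded[OF compact_continuous_image[OF u compact_Icc]] unfolding bounded_pos by auto
  define \<delta> where "\<delta> = e / (2 * M * k)"
  have \<delta>: "\<delta> > 0" using \<open>e > 0\<close> k M_pos by (simp add: \<delta>_def)
  define s where "s = max t (r0 - \<delta>)"
  have s: "t \<le> s" "s \<le> b" "s \<ge> r0 - \<delta>"
    and above: "{t..b} \<inter> ball r0 \<delta> \<subseteq> {s..b}"
    using r0 \<delta> by (auto simp: s_def dist_real_def)
  define J where "J = integral {t..s} (\<lambda>q. U s q (u q))"
  have "continuous_on ({t..b} \<inter> ball r0 \<delta>) (\<lambda>r. U r s J)"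
    by (rule continuous_on_subset[OF U_cont1[of s]]) (use above s tb in auto)
  moreover have "norm (integral {t..r} (\<lambda>q. U r q (u q)) - U r s J) \<le> e"
    if r: "r \<in> {t..b} \<inter> ball r0 \<delta>" for r
  proof -
    have r': "s \<le> r" "r \<le> b" using r above by auto
    have "r < r0 + \<delta>" using r by (auto simp: dist_real_def)
    then have "r - s \<le> 2 * \<delta>" using s by simp
    have "norm (integral {s..r} (\<lambda>q. U r q (u q))) \<le> M * k * (r - s)"
      using s r' tb M_pos
      by (intro integral_bound Uu_continuous order_trans[OF U_bound] mult_left_mono k) auto
    also have "\<dots> \<le> M * k * (2 * \<delta>)"
      using \<open>r - s \<le> 2 * \<delta>\<close> M_pos k by (intro mult_left_mono) auto
    also have "\<dots> = e"
      using M_pos k by (simp add: \<delta>_def)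
    finally show ?thesis
      unfolding duhamel_flow[OF s(1) r'] J_def by simp
  qed
  ultimately show "\<exists>\<delta>>0. \<exists>g. continuous_on ({t..b} \<inter> ball r0 \<delta>) g \<and>
      (\<forall>r\<in>{t..b} \<inter> ball r0 \<delta>. norm (integral {t..r} (\<lambda>q. U r q (u q)) - g r) \<le> e)"
    using \<delta> by blast
qed

end

text \<open>With \<open>P\<close> given, the equation is linear in \<open>z\<close>, and the
  exponential weight yields a contraction on all of \<open>{t..b}\<close> at once.\<close>

lemma closed_loop_trajectory:
  assumes P: "opfun a b R P" "R > 0" and ab: "0 \<le> a" "b \<le> T" and t: "a \<le> t" "t \<le> b"
  obtains z where "continuous_on {t..b} z"
    "\<And>r. t \<le> r \<Longrightarrow> r \<le> b \<Longrightarrow> z r = U r t x - integral {t..r} (\<lambda>q. U r q (B q (P q (z q))))"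
proof -
  have t': "0 \<le> t" using t ab by simp
  define W where "W q y = B q (P q y)" for q y
  \<comment> \<open>Twice the Lipschitz constant \<open>M * (kB * R)\<close> of the integrand, so
    that the gain \<open>1 / \<mu>\<close> leaves 1/2.\<close>
  define \<mu> where "\<mu> = 2 * M * (kB * R)"
  have \<mu>: "\<mu> > 0" using M_pos P(2) kB_pos by (simp add: \<mu>_def)
  define F where "F z r = U r t x - integral {t..r} (\<lambda>q. U r q (W q (z q)))" for z r
  have W_cont: "continuous_on {t..b} (\<lambda>q. W q (z q))" if "continuous_on {t..b} z" for z
    unfolding W_def by (rule BP_continuous[OF P(1) ab t(1) order_refl that])
  have W_lip: "norm (W q y - W q z) \<le> kB * R * norm (y - z)" if q: "t \<le> q" "q \<le> b" for q y z
  proof -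
    have q': "0 \<le> q" "q \<le> T" "a \<le> q" using q t ab by auto
    have "norm (W q y - W q z) \<le> kB * norm (P q y - P q z)"
      unfolding W_def by (rule B_bound_diff[OF q'(1,2) opfunD(4)[OF P(1) q'(3) q(2)] opfunD(4)[OF P(1) q'(3) q(2)]])
    also have "\<dots> \<le> kB * (R * norm (y - z))"
      using kB_pos by (intro mult_left_mono opfunD(5)[OF P(1) q'(3) q(2)]) auto
    finally show ?thesis by simp
  qed
  have F_cont: "continuous_on {t..b} (F z)" if "continuous_on {t..b} z" for z
  proof -
    have "continuous_on {t..b} (\<lambda>r. U r t x)"
      by (rule continuous_on_subset[OF U_cont1]) (use t t' ab in auto)
    then show ?thesis
      unfolding F_def by (intro continuous_on_diff duhamel_continuous[OF t' ab(2)] W_cont that)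
  qed
  define z0 :: "real \<Rightarrow> 'a" where "z0 = (\<lambda>_. 0)"
  have z0: "continuous_on {t..b} z0" by (simp add: z0_def)
  obtain d where d: "d > 0" "\<And>r. r \<in> {t..b} \<Longrightarrow> norm (F z0 r) \<le> d"
    using compact_imp_bounded[OF compact_continuous_image[OF F_cont[OF z0] compact_Icc]]
    unfolding bounded_pos by auto
  obtain z where z: "z \<in> {z. continuous_on {t..b} z}" "\<And>r. r \<in> {t..b} \<Longrightarrow> F z r = z r"
  proof (rule weighted_contraction_fixpoint[where F = F and S = "{z. continuous_on {t..b} z}" and I = "{t..b}"
        and w = "\<lambda>r. exp (\<mu> * (r - t))" and d = d and ?f0.0 = z0])
    fix r assume r: "r \<in> {t..b}"
    have "norm (F z0 r - z0 r) \<le> d * 1"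
      using d(2)[OF r] by (simp add: z0_def)
    also have "\<dots> \<le> d * exp (\<mu> * (r - t))"
      using d(1) r \<mu> by (intro mult_left_mono) auto
    finally show "norm (F z0 r - z0 r) \<le> d * exp (\<mu> * (r - t))" .
  next
    fix f g :: "real \<Rightarrow> 'a" and c r :: real
    assume fg: "f \<in> {z. continuous_on {t..b} z}" "g \<in> {z. continuous_on {t..b} z}" and c: "c > 0"
      and fg_le: "\<And>q. q \<in> {t..b} \<Longrightarrow> norm (f q - g q) \<le> c * exp (\<mu> * (q - t))" and r: "r \<in> {t..b}"
    then have r': "t \<le> r" "r \<le> b" by auto
    have int: "(\<lambda>q. U r q (W q (f q))) integrable_on {t..r}" "(\<lambda>q. U r q (W q (g q))) integrable_on {t..r}"
      using fg r' by (auto intro!: integrable_continuous_real Uu_continuous[OF t' ab(2)] W_cont)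
    have eq: "F f r - F g r = integral {t..r} (\<lambda>q. U r q (W q (g q)) - U r q (W q (f q)))"
      unfolding F_def by (simp add: integral_diff int)
    have "norm (integral {t..r} (\<lambda>q. U r q (W q (g q)) - U r q (W q (f q))))
        \<le> integral {t..r} (\<lambda>q. M * (kB * R * c) * exp (\<mu> * (q - t)))"
    proof (rule integral_norm_bound_integral)
      show "(\<lambda>q. M * (kB * R * c) * exp (\<mu> * (q - t))) integrable_on {t..r}"
        by (intro integrable_continuous_real continuous_intros)
      fix q assume "q \<in> {t..r}"
      then have q: "t \<le> q" "q \<le> r" "0 \<le> q" "r \<le> T" "q \<in> {t..b}" using r' t' ab by auto
      have "norm (U r q (W q (g q)) - U r q (W q (f q))) \<le> M * norm (W q (g q) - W q (f q))"
        by (rule U_bound_diff[OF q(3,2,4)])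
      also have "\<dots> \<le> M * (kB * R * norm (g q - f q))"
        using M_pos q by (intro mult_left_mono W_lip) auto
      also have "\<dots> \<le> M * (kB * R * (c * exp (\<mu> * (q - t))))"
        unfolding norm_minus_commute[of "g q"] using M_pos kB_pos P(2)
        by (intro mult_left_mono fg_le q(5)) auto
      finally show "norm (U r q (W q (g q)) - U r q (W q (f q))) \<le> M * (kB * R * c) * exp (\<mu> * (q - t))"
        by simp
    qed (intro integrable_diff int)
    moreover have "integral {t..r} (\<lambda>q. M * (kB * R * c) * exp (\<mu> * (q - t)))
        = M * (kB * R * c) * integral {t..r} (\<lambda>q. exp (\<mu> * (q - t)))"
      by (rule integral_mult_right)
    moreover have "M * (kB * R * c) * integral {t..r} (\<lambda>q. exp (\<mu> * (q - t)))
        \<le> M * (kB * R * c) * (exp (\<mu> * (r - t)) / \<mu>)"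
      using M_pos kB_pos P(2) c by (intro mult_left_mono integral_exp_le(1)[OF \<mu> r'(1)]) auto
    moreover have "M * (kB * R * c) * (exp (\<mu> * (r - t)) / \<mu>) = c / 2 * exp (\<mu> * (r - t))"
    proof -
      have "M * (kB * R * c) = c / 2 * \<mu>" by (simp add: \<mu>_def)
      then show ?thesis unfolding \<open>M * (kB * R * c) = c / 2 * \<mu>\<close> using \<mu> by simp
    qed
    ultimately show "norm (F f r - F g r) \<le> c / 2 * exp (\<mu> * (r - t))"
      unfolding eq by linarith
  next
    fix f and s :: "nat \<Rightarrow> real \<Rightarrow> 'a"
    assume s: "\<And>n. s n \<in> {z. continuous_on {t..b} z}"
      and lim: "\<And>e. e > 0 \<Longrightarrow> \<exists>N. \<forall>n\<ge>N. \<forall>r\<in>{t..b}. norm (s n r - f r) \<le> e * exp (\<mu> * (r - t))"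
    have "continuous_on {t..b} f"
    proof (rule continuous_on_locally_approximable)
      fix r0 e :: real assume "e > 0"
      define e' where "e' = e / exp (\<mu> * (b - t))"
      have "e' > 0" using \<open>e > 0\<close> by (simp add: e'_def)
      from lim[OF this] obtain N where N: "\<forall>n\<ge>N. \<forall>r\<in>{t..b}. norm (s n r - f r) \<le> e' * exp (\<mu> * (r - t))" ..
      have "norm (f r - s N r) \<le> e" if r: "r \<in> {t..b}" for r
      proof -
        have "norm (f r - s N r) \<le> e' * exp (\<mu> * (r - t))"
          using N r by (simp add: norm_minus_commute)
        also have "\<dots> \<le> e' * exp (\<mu> * (b - t))"
          using \<open>e' > 0\<close> \<mu> r by (intro mult_left_mono) auto
        also have "\<dots> = e" by (simp add: e'_def)
        finally show ?thesis .
      qed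
      moreover have "continuous_on ({t..b} \<inter> ball r0 1) (s N)"
        by (rule continuous_on_subset[of "{t..b}"]) (use s in auto)
      ultimately show "\<exists>\<delta>>0. \<exists>g. continuous_on ({t..b} \<inter> ball r0 \<delta>) g \<and>
          (\<forall>t\<in>{t..b} \<inter> ball r0 \<delta>. norm (f t - g t) \<le> e)"
        using zero_less_one by blast
    qed
    then show "f \<in> {z. continuous_on {t..b} z}" by simp
  qed (use z0 F_cont d in auto)
  show thesis
  proof (rule that)
    show "continuous_on {t..b} z" using z(1) by simp
    show "z r = U r t x - integral {t..r} (\<lambda>q. U r q (B q (P q (z q))))" if "t \<le> r" "r \<le> b" for r
      using z(2)[of r] that unfolding F_def W_def by simp
  qed
qed

text \<open>The converse of gluing: any later value \<open>P s\<close> may serve as terminal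
  operator.\<close>

lemma sol_restrict:
  assumes P: "sol a b R H P" "R \<ge> 0" and H: "\<And>x. H x \<in> D" and ab: "0 \<le> a" "b \<le> T"
    and r: "a \<le> r" "r \<le> s" "s \<le> b"
  shows "P r x = Lam s (P s) (source P) r x"
proof -
  note oP = P(1)[unfolded sol_def, THEN conjunct1]
  have L: "Lam b H (source P) s = P s"
  proof
    show "Lam b H (source P) s y = P s y" for y
      by (rule sol_eq[OF P(1), symmetric]) (use r in auto)
  qed
  have "P r x = Lam b H (source P) r x"
    by (rule sol_eq[OF P(1)]) (use r in auto)
  also have "\<dots> = V r s (Lam b H (source P) s (U s r x)) + integral {r..s} (\<lambda>q. V r q (source P q (U q r x)))"
  proof (rule Lam_flow[OF opfun_source[OF oP P(2) ab] ab H _ r])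
    show "Lam b H (source P) s y \<in> D" for y
      unfolding L by (rule opfunD(4)[OF oP]) (use r in auto)
  qed
  finally show ?thesis
    by (simp only: L Lam_def)
qed

text \<open>The energy identity between \<open>r\<close> and \<open>s\<close> along the free
  flow.\<close>

lemma sol_pairing:
  assumes P: "sol a b R H P" "R \<ge> 0" and H: "\<And>x. H x \<in> D" and ab: "0 \<le> a" "b \<le> T"
    and r: "a \<le> r" "r \<le> s" "s \<le> b"
  shows "\<langle>P r x, y\<rangle> = \<langle>P s (U s r x), U s r y\<rangle> + integral {r..s} (\<lambda>q. \<langle>source P q (U q r x), U q r y\<rangle>)"
    and "(\<lambda>q. \<langle>source P q (U q r x), U q r y\<rangle>) integrable_on {r..s}"
proof -
  note oP = P(1)[unfolded sol_def, THEN conjunct1]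
  have src: "opfun a s (kC + R\<^sup>2 * kB) (source P)"
    by (rule opfun_subset[OF opfun_source[OF oP P(2) ab]]) (use r in auto)
  have "s \<le> T" using r ab by simp
  have "P s x \<in> D" for x
    by (rule opfunD(4)[OF oP]) (use r in auto)
  from Lam_pairing[OF src ab(1) \<open>s \<le> T\<close> this r(1,2), where x=x and y=y]
  show "\<langle>P r x, y\<rangle> = \<langle>P s (U s r x), U s r y\<rangle> + integral {r..s} (\<lambda>q. \<langle>source P q (U q r x), U q r y\<rangle>)"
    by (simp only: sol_restrict[OF P H ab r, of x])
  show "(\<lambda>q. \<langle>source P q (U q r x), U q r y\<rangle>) integrable_on {r..s}"
    by (rule pairing_integrable[OF src ab(1) \<open>s \<le> T\<close> r(1,2)])
qed

lemma re_pairing_swap: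
  assumes "selfadjoint_X_dual scl A"
  shows "re_part \<langle>A x, y\<rangle> = re_part \<langle>A y, x\<rangle>"
  using re_part_conj[of "\<langle>A y, x\<rangle>"] selfadjoint_X_dualD(2)[OF assms, of x y] by simp

lemma re_C_nonneg: "0 \<le> t \<Longrightarrow> t \<le> T \<Longrightarrow> re_part \<langle>C t x, x\<rangle> \<ge> 0"
  using C_nonneg unfolding nonneg_X_dual_def by (blast intro: re_part_nonneg)

lemma re_B_nonneg: "0 \<le> t \<Longrightarrow> t \<le> T \<Longrightarrow> y \<in> D \<Longrightarrow> re_part \<langle>y, B t y\<rangle> \<ge> 0"
  using B_nonneg unfolding nonneg_dual_X_def by (blast intro: re_part_nonneg)

text \<open>Self-adjointness moves the outer \<open>P q\<close> to the other side, so the quadratic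
  term becomes the form of \<open>B q\<close> at \<open>P q y\<close>, whose sign is known.\<close>

lemma re_source:
  assumes "selfadjoint_X_dual scl (P q)"
  shows "re_part \<langle>source P q y, y\<rangle> = re_part \<langle>C q y, y\<rangle> - re_part \<langle>P q y, B q (P q y)\<rangle>"
  using re_pairing_swap[OF assms, of "B q (P q y)" y]
  by (simp add: source_def blinfun.diff_left re_part_diff)

text \<open>Along a closed loop trajectory \<open>z\<close>, the value \<open>\<langle>P r (z r), z r\<rangle>\<close> has the right derivative
  \<open>- \<langle>C z, z\<rangle> - \<langle>P z, B P z\<rangle>\<close>. A left derivative need not exist, because \<open>U s q x\<close> is jointly continuous
  in \<open>r \<le> q \<le> s\<close> near the diagonal point \<open>(r, r)\<close>, but not necessarily in \<open>q \<le> s \<le> r\<close>.\<close>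

lemma sol_nonneg:
  assumes P: "sol a b R H P" "R > 0" and sa: "\<And>r. a \<le> r \<Longrightarrow> r \<le> b \<Longrightarrow> selfadjoint_X_dual scl (P r)"
    and H: "\<And>x. H x \<in> D" "\<And>x. re_part \<langle>H x, x\<rangle> \<ge> 0" and ab: "0 \<le> a" "b \<le> T"
    and t: "a \<le> t" "t \<le> b"
  shows "re_part \<langle>P t x, x\<rangle> \<ge> 0"
proof -
  note oP = P(1)[unfolded sol_def, THEN conjunct1]
  have R': "R \<ge> 0" and t': "0 \<le> t" using P(2) t ab by auto
  obtain z where z_cont: "continuous_on {t..b} z"
    and z: "\<And>r. t \<le> r \<Longrightarrow> r \<le> b \<Longrightarrow> z r = U r t x - integral {t..r} (\<lambda>q. U r q (B q (P q (z q))))"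
    using closed_loop_trajectory[OF oP P(2) ab t] by blast
  define u where "u q = B q (P q (z q))" for q
  have u_cont: "continuous_on {t..b} u"
    unfolding u_def by (rule BP_continuous[OF oP ab t(1) order_refl z_cont])
  define \<phi> where "\<phi> r = re_part \<langle>P r (z r), z r\<rangle>" for r
  have Pz_cont: "continuous_on {t..b} (\<lambda>r. P r (z r))"
    by (rule opfun_apply_continuous[OF oP t(1) order_refl z_cont])
  have "\<phi> b \<le> \<phi> t"
  proof (rule nonincreasing_if_right_Dini[OF t(2)])
    show "continuous_on {t..b} \<phi>"
      unfolding \<phi>_def
      by (intro bounded_linear.continuous_on[OF bounded_linear_re_part] blinfun.continuous_on Pz_cont z_cont)
    fix r e :: real assume r: "t \<le> r" "r < b" and e: "e > 0"
    have r': "0 \<le> r" "r \<le> T" "a \<le> r" "r \<le> b" using r t t' ab by auto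
    have PD: "P q y \<in> D" if "r \<le> q" "q \<le> b" for q y
      by (rule opfunD(4)[OF oP]) (use that r' in auto)
    have right: "(f \<longlongrightarrow> f r) (at_right r)" if "continuous_on {r..b} f" for f :: "real \<Rightarrow> 'c::real_normed_vector"
      using that r at_within_Icc_at_right[OF r(2)] unfolding continuous_on_def by force
    have sub: "{r..b} \<subseteq> {t..b}" using r by auto
    have z_flow: "z s = U s r (z r) - integral {r..s} (\<lambda>q. U s q (u q))" if s: "r \<le> s" "s \<le> b" for s
    proof -
      have "U s r (z r) = U s r (U r t x) - U s r (integral {t..r} (\<lambda>q. U r q (u q)))"
        using r' s ab by (simp add: z[OF r(1) r'(4)] u_def U_diff)
      also have "U s r (U r t x) = U s t x"
        using r s t' ab by (intro U_trans) auto
      finally show ?thesis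
        using z[of s] duhamel_flow[OF t' ab(2) u_cont r(1) s] r s by (simp add: u_def)
    qed
    \<comment> \<open>The free flow from \<open>z r\<close> differs from the trajectory by
      \<open>\<Delta> s\<close>, which is \<open>(s - r) *\<^sub>R u r\<close> to first
      order.\<close>
    define \<Delta> where "\<Delta> s = integral {r..s} (\<lambda>q. U s q (u q))" for s
    define g where "g q = re_part \<langle>P q (U q r (z r)), B q (P q (U q r (z r)))\<rangle>" for q
    have U_cont: "continuous_on {r..b} (\<lambda>q. U q r y)" for y
      by (rule continuous_on_subset[OF U_cont1[of r]]) (use r' ab in auto)
    have g_cont: "continuous_on {r..b} g"
      unfolding g_def
      by (intro bounded_linear.continuous_on[OF bounded_linear_re_part] blinfun.continuous_on
          opfun_apply_continuous[OF oP r'(3) order_refl] BP_continuous[OF oP ab r'(3) order_refl] U_cont)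
    have g_r: "g r = re_part \<langle>P r (z r), u r\<rangle>"
      by (simp add: g_def u_def U_refl r')
    have g_pos: "g r \<ge> 0"
      unfolding g_def by (intro re_B_nonneg PD) (use r' r in auto)

    \<comment> \<open>The energy identity along the free flow from \<open>z r\<close>, with the form
      of \<open>P s\<close> expanded at \<open>z s + \<Delta> s\<close> and the contribution of
      \<open>C\<close> dropped by its sign. To first order the right-hand side is
      \<open>s - r\<close> times \<open>- 2 * g r + g r\<close>, which is nonpositive.\<close>
    have step: "\<phi> s - \<phi> r \<le> - 2 * re_part \<langle>P s (z s), \<Delta> s\<rangle> - re_part \<langle>P s (\<Delta> s), \<Delta> s\<rangle> + integral {r..s} g"
      if s: "r \<le> s" "s \<le> b" for s
    proof -
      have s': "a \<le> s" using s r' by simp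
      note pl = L_X_dual_simps[OF opfunD(1)[OF oP s' s(2)]]
      note int = sol_pairing[OF P(1) R' H(1) ab r'(3) s, of "z r" "z r"]
      have "re_part (integral {r..s} (\<lambda>q. \<langle>source P q (U q r (z r)), U q r (z r)\<rangle>))
          = integral {r..s} (\<lambda>q. re_part \<langle>source P q (U q r (z r)), U q r (z r)\<rangle>)"
        using integral_linear[OF int(2) bounded_linear_re_part] by (simp add: o_def)
      moreover have "- integral {r..s} g \<le> integral {r..s} (\<lambda>q. re_part \<langle>source P q (U q r (z r)), U q r (z r)\<rangle>)"
        unfolding integral_neg[symmetric]
      proof (rule integral_le)
        show "(\<lambda>q. - g q) integrable_on {r..s}"
          by (intro integrable_continuous_real continuous_on_minus continuous_on_subset[OF g_cont]) (use s in auto)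
        show "(\<lambda>q. re_part \<langle>source P q (U q r (z r)), U q r (z r)\<rangle>) integrable_on {r..s}"
          using integrable_linear[OF int(2) bounded_linear_re_part] by (simp add: o_def)
        fix q assume q: "q \<in> {r..s}"
        have "re_part \<langle>C q (U q r (z r)), U q r (z r)\<rangle> \<ge> 0"
          by (rule re_C_nonneg) (use q r' s ab in auto)
        moreover have "selfadjoint_X_dual scl (P q)"
          by (rule sa) (use q r' s in auto)
        ultimately show "- g q \<le> re_part \<langle>source P q (U q r (z r)), U q r (z r)\<rangle>"
          by (simp add: re_source g_def)
      qed
      moreover have "re_part \<langle>P s (U s r (z r)), U s r (z r)\<rangle>
          = \<phi> s + 2 * re_part \<langle>P s (z s), \<Delta> s\<rangle> + re_part \<langle>P s (\<Delta> s), \<Delta> s\<rangle>"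
      proof -
        have "U s r (z r) = z s + \<Delta> s" using z_flow[OF s] by (simp add: \<Delta>_def)
        then show ?thesis
          using re_pairing_swap[OF sa[OF s' s(2)], of "\<Delta> s" "z s"]
          by (simp add: \<phi>_def pl(2) blinfun.add_left blinfun.add_right re_part_add)
      qed
      moreover have "\<phi> r = re_part \<langle>P s (U s r (z r)), U s r (z r)\<rangle>
          + re_part (integral {r..s} (\<lambda>q. \<langle>source P q (U q r (z r)), U q r (z r)\<rangle>))"
        unfolding \<phi>_def int(1) by (rule re_part_add)
      ultimately show ?thesis by linarith
    qed

    have lim_\<Delta>: "((\<lambda>s. (1 / (s - r)) *\<^sub>R \<Delta> s) \<longlongrightarrow> u r) (at_right r)"
      unfolding \<Delta>_def
    proof (rule tendsto_average_at_right[OF r(2)])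
      show "continuous_on {r..s} (\<lambda>q. U s q (u q))" if "r < s" "s \<le> b" for s
        by (rule Uu_continuous[OF t' ab(2) u_cont r(1)]) (use that in auto)
      fix e :: real assume "e > 0"
      \<comment> \<open>Three differences will be added, two of them carrying a factor
        \<open>M\<close>.\<close>
      define e' where "e' = e / (2 * M + 1)"
      have e': "e' > 0" using \<open>e > 0\<close> M_pos by (simp add: e'_def)
      obtain \<delta>1 where \<delta>1: "\<delta>1 > 0" "\<And>s. r \<le> s \<Longrightarrow> s < r + \<delta>1 \<Longrightarrow> s \<le> b \<Longrightarrow> norm (u s - u r) \<le> e'"
        by (rule continuous_on_Icc_left_end[OF continuous_on_subset[OF u_cont sub] r(2) e']) blast
      obtain \<delta>2 where \<delta>2: "\<delta>2 > 0"
        "\<And>s. r \<le> s \<Longrightarrow> s < r + \<delta>2 \<Longrightarrow> s \<le> b \<Longrightarrow> norm (U s r (u r) - U r r (u r)) \<le> e'"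
        by (rule continuous_on_Icc_left_end[OF U_cont r(2) e']) blast
      have "norm (U s q (u q) - u r) \<le> e"
        if q: "r \<le> q" "q \<le> s" "s < r + min \<delta>1 \<delta>2" "s \<le> b" for s q
      proof -
        have q': "0 \<le> q" "s \<le> T" using q r' ab by auto
        have 1: "norm (U s q (u q) - U s q (u r)) \<le> M * e'"
          using M_pos q by (intro order_trans[OF U_bound_diff[OF q'(1) q(2) q'(2)]] mult_left_mono \<delta>1(2)) auto
        have "norm (U q r (u r) - u r) \<le> e'"
          using \<delta>2(2)[of q] q r' by (simp add: U_refl)
        \<comment> \<open>Replacing \<open>u r\<close> by \<open>U q r (u r)\<close> costs at most
          \<open>M * e'\<close>; then \<open>U s q\<close> and \<open>U q r\<close> compose to
          \<open>U s r\<close>. Thus strong continuity in the first index at \<open>r\<close>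
          suffices, provided that \<open>r \<le> q \<le> s\<close>.\<close>
        then have "norm (U s q (u r) - U s q (U q r (u r))) \<le> M * e'"
          using M_pos by (intro order_trans[OF U_bound_diff[OF q'(1) q(2) q'(2)]] mult_left_mono)
            (auto simp: norm_minus_commute)
        then have 2: "norm (U s q (u r) - U s r (u r)) \<le> M * e'"
          using U_trans[OF r'(1) q(1,2) q'(2)] by simp
        have 3: "norm (U s r (u r) - u r) \<le> e'"
          using \<delta>2(2)[of s] q r' by (simp add: U_refl)
        have "norm (U s q (u q) - u r) \<le> norm (U s q (u q) - U s q (u r)) + norm (U s q (u r) - U s r (u r))
            + norm (U s r (u r) - u r)"
          using norm_triangle_ineq[of "U s q (u q) - U s q (u r)" "U s q (u r) - U s r (u r)"]
            norm_triangle_ineq[of "U s q (u q) - U s r (u r)" "U s r (u r) - u r"] by simp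
        also have "\<dots> \<le> (2 * M + 1) * e'"
          using 1 2 3 by (simp add: distrib_right)
        also have "\<dots> = e"
          using M_pos by (simp add: e'_def)
        finally show ?thesis .
      qed
      then show "\<exists>\<delta>>0. \<forall>s q. r \<le> q \<longrightarrow> q \<le> s \<longrightarrow> s < r + \<delta> \<longrightarrow> s \<le> b \<longrightarrow> norm (U s q (u q) - u r) \<le> e"
        using \<delta>1(1) \<delta>2(1) by (intro exI[of _ "min \<delta>1 \<delta>2"]) auto
    qed
    have lim_g: "((\<lambda>s. (1 / (s - r)) *\<^sub>R integral {r..s} g) \<longlongrightarrow> g r) (at_right r)"
    proof (rule tendsto_average_at_right[OF r(2)])
      show "continuous_on {r..s} g" if "r < s" "s \<le> b" for s
        by (rule continuous_on_subset[OF g_cont]) (use that in auto)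
      fix e :: real assume "e > 0"
      then obtain \<delta> where "\<delta> > 0" "\<And>s. r \<le> s \<Longrightarrow> s < r + \<delta> \<Longrightarrow> s \<le> b \<Longrightarrow> norm (g s - g r) \<le> e"
        by (rule continuous_on_Icc_left_end[OF g_cont r(2)]) blast
      then show "\<exists>\<delta>>0. \<forall>s q. r \<le> q \<longrightarrow> q \<le> s \<longrightarrow> s < r + \<delta> \<longrightarrow> s \<le> b \<longrightarrow> norm (g q - g r) \<le> e"
        by (intro exI[of _ \<delta>]) auto
    qed
    have pos: "eventually (\<lambda>s. s \<in> {r<..<b}) (at_right r)"
      using r(2) by (rule eventually_at_right_real)
    have lim_\<Delta>0: "(\<Delta> \<longlongrightarrow> 0) (at_right r)"
    proof (rule Lim_transform_eventually)
      have "((\<lambda>s. (s - r) *\<^sub>R ((1 / (s - r)) *\<^sub>R \<Delta> s)) \<longlongrightarrow> (r - r) *\<^sub>R u r) (at_right r)"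
        by (intro tendsto_intros lim_\<Delta>)
      then show "((\<lambda>s. (s - r) *\<^sub>R ((1 / (s - r)) *\<^sub>R \<Delta> s)) \<longlongrightarrow> 0) (at_right r)" by simp
      show "eventually (\<lambda>s. (s - r) *\<^sub>R ((1 / (s - r)) *\<^sub>R \<Delta> s) = \<Delta> s) (at_right r)"
        using pos by (rule eventually_mono) auto
    qed
    have lim_P\<Delta>: "((\<lambda>s. P s (\<Delta> s)) \<longlongrightarrow> 0) (at_right r)"
    proof (rule Lim_null_comparison)
      show "eventually (\<lambda>s. norm (P s (\<Delta> s)) \<le> R * norm (\<Delta> s)) (at_right r)"
        using pos by (rule eventually_mono) (use r' in \<open>auto intro!: opfunD(2)[OF oP]\<close>)
      show "((\<lambda>s. R * norm (\<Delta> s)) \<longlongrightarrow> 0) (at_right r)"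
        using tendsto_mult[OF tendsto_const[of R] tendsto_norm[OF lim_\<Delta>0]] by simp
    qed
    have lim_Pz: "((\<lambda>s. P s (z s)) \<longlongrightarrow> P r (z r)) (at_right r)"
      by (rule right[OF continuous_on_subset[OF Pz_cont sub]])
    \<comment> \<open>The second-order term: \<open>P s (\<Delta> s)\<close> tends to 0 while the
      quotient of \<open>\<Delta> s\<close> by \<open>s - r\<close> converges.\<close>
    have "((\<lambda>s. re_part \<langle>P s (\<Delta> s), (1 / (s - r)) *\<^sub>R \<Delta> s\<rangle>) \<longlongrightarrow> re_part \<langle>0 :: 'a \<Rightarrow>\<^sub>L 'k, u r\<rangle>) (at_right r)"
      by (rule bounded_linear.tendsto[OF bounded_linear_re_part blinfun.tendsto[OF lim_P\<Delta> lim_\<Delta>]])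
    moreover have "((\<lambda>s. re_part \<langle>P s (z s), (1 / (s - r)) *\<^sub>R \<Delta> s\<rangle>) \<longlongrightarrow> re_part \<langle>P r (z r), u r\<rangle>) (at_right r)"
      by (rule bounded_linear.tendsto[OF bounded_linear_re_part blinfun.tendsto[OF lim_Pz lim_\<Delta>]])
    moreover define E where "E s = - 2 * re_part \<langle>P s (z s), (1 / (s - r)) *\<^sub>R \<Delta> s\<rangle>
      - re_part \<langle>P s (\<Delta> s), (1 / (s - r)) *\<^sub>R \<Delta> s\<rangle> + (1 / (s - r)) *\<^sub>R integral {r..s} g" for s
    ultimately have "(E \<longlongrightarrow> - 2 * re_part \<langle>P r (z r), u r\<rangle> - re_part \<langle>0 :: 'a \<Rightarrow>\<^sub>L 'k, u r\<rangle> + g r) (at_right r)"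
      unfolding E_def
      by (intro tendsto_intros lim_g)
    \<comment> \<open>The limit equals \<open>- g r\<close>, hence lies below every positive
      \<open>e\<close>.\<close>
    moreover have "- 2 * re_part \<langle>P r (z r), u r\<rangle> - re_part \<langle>0 :: 'a \<Rightarrow>\<^sub>L 'k, u r\<rangle> + g r < e"
      using g_pos e re_part_of_real[of 0, where 'k = 'k] by (simp add: g_r blinfun.zero_left)
    ultimately have "eventually (\<lambda>s. E s < e) (at_right r)"
      by (rule order_tendstoD(2))
    with pos show "eventually (\<lambda>s. \<phi> s - \<phi> r \<le> e * (s - r)) (at_right r)"
    proof eventually_elim
      case (elim s)
      then have s: "s - r > 0" "r \<le> s" "s \<le> b" by auto
      have "(s - r) * E s
          = - 2 * re_part \<langle>P s (z s), \<Delta> s\<rangle> - re_part \<langle>P s (\<Delta> s), \<Delta> s\<rangle> + integral {r..s} g"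
        using s(1) by (simp add: E_def blinfun.scaleR_right re_part_scaleR distrib_left right_diff_distrib)
      then have "\<phi> s - \<phi> r \<le> (s - r) * E s"
        using step[OF s(2,3)] by simp
      also have "\<dots> \<le> (s - r) * e"
        using s(1) elim(2) by (intro mult_left_mono) auto
      finally show ?case by (simp add: mult.commute)
    qed
  qed
  moreover have "\<phi> b \<ge> 0"
  proof -
    have "P b (z b) = H (z b)"
      using sol_eq[OF P(1), of b "z b"] Lam_terminal[of b H "z b"] H(1) t t' ab by simp
    then show ?thesis using H(2) by (simp add: \<phi>_def)
  qed
  moreover have "z t = x"
    using z[of t] t t' ab by (simp add: U_refl)
  then have "\<phi> t = re_part \<langle>P t x, x\<rangle>"
    by (simp add: \<phi>_def)
  ultimately show ?thesis by simp
qed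

end

section \<open>Global solutions\<close>

context banach_over
begin

text \<open>Uniform boundedness with a single index turns continuity into a norm bound, so that
  \<open>onorm\<close> is a genuine bound.\<close>

lemma L_X_X_bounded_linear:
  assumes "A \<in> L_X_X scl"
  shows "bounded_linear A"
proof -
  have lin: "linear A" by (rule L_X_X_linear[OF assms])
  obtain K where K: "\<And>i x. i \<in> {()} \<Longrightarrow> x \<in> UNIV \<Longrightarrow> norm (A x) \<le> K * norm x"
  proof (rule uniform_boundedness_on[of UNIV "{()}" "\<lambda>_. A"])
    show "continuous_on UNIV A" by (rule operators_continuous[OF assms])
  qed (auto intro: linear_add[OF lin] linear_scale[OF lin])
  then show ?thesis
    using linear_add[OF lin] linear_scale[OF lin]
    by (intro bounded_linear_intro[of A K]) (auto simp: mult.commute)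
qed

end

context riccati_data
begin

lemma opfun_mono:
  assumes "opfun a b R P" "R \<le> R'"
  shows "opfun a b R' P"
proof -
  have "R * norm x \<le> R' * norm x" for x :: 'a
    using assms(2) by (rule mult_right_mono) simp
  then show ?thesis
    using assms(1) unfolding opfun_def by (meson order_trans)
qed

text \<open>Compactness of the interval bounds \<open>P t x\<close> for each \<open>x\<close>, and
  uniform boundedness makes one radius of these bounds.\<close>

lemma Cs_X_dual_opfun:
  assumes "P \<in> Cs_X_dual scl T"
  obtains R where "R > 0" "opfun 0 T R P"
proof -
  have bdd: "bounded ((\<lambda>t. P t x) ` {0..T})" for x
    using assms by (intro compact_imp_bounded compact_continuous_image) (auto simp: Cs_X_dual_def)
  have "P t \<in> L_X_dual scl" if "t \<in> {0..T}" for t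
    using assms that by (auto simp: Cs_X_dual_def)
  from uniformly_bounded_L_X_dual[OF this bdd]
  obtain R where "R > 0" "\<And>t x. t \<in> {0..T} \<Longrightarrow> norm (P t x) \<le> R * norm x" by blast
  then show thesis
    using assms by (intro that[of R]) (auto simp: Cs_X_dual_def opfun_def)
qed

lemma opfun_Cs_X_dual: "opfun 0 T R P \<Longrightarrow> P \<in> Cs_X_dual scl T"
  by (auto simp: opfun_def Cs_X_dual_def)

text \<open>Continuity of the integrand supplies the integrability clause on the left; the assumed
  ball supplies the radius on the right.\<close>

lemma riccati_solution_iff_sol:
  assumes "opfun 0 T R P" "R \<ge> 0"
  shows "riccati_solution T U V C B G P \<longleftrightarrow> sol 0 T R G P"
proof -
  have "(\<lambda>r. V t r (source P r (U r t x))) integrable_on {t..T}" if "t \<in> {0..T}" for t x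
    using that by (intro VKU_integrable[OF opfun_source[OF assms]]) auto
  then show ?thesis
    unfolding riccati_solution_def sol_def Lam_def source_def using assms(1) by blast
qed

text \<open>The bound does not depend on \<open>a\<close>, so that solutions can be continued down to \<open>0\<close>.\<close>

lemma sol_a_priori_bound:
  assumes P: "sol a T R H P" "R > 0" and sa: "\<And>r. a \<le> r \<Longrightarrow> r \<le> T \<Longrightarrow> selfadjoint_X_dual scl (P r)"
    and H: "\<And>x. H x \<in> D" "\<And>x. re_part \<langle>H x, x\<rangle> \<ge> 0" "\<And>x. norm (H x) \<le> h * norm x" "h \<ge> 0"
    and a: "0 \<le> a" and t: "a \<le> t" "t \<le> T"
  shows "norm (P t x) \<le> M\<^sup>2 * (h + kC * T) * norm x"
proof (rule norm_le_of_quadratic_form_le[OF sa[OF t]])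
  show "re_part \<langle>P t x, x\<rangle> \<ge> 0" for x
    by (rule sol_nonneg[OF P sa H(1,2) a order_refl t])
  show "re_part \<langle>P t x, x\<rangle> \<le> M\<^sup>2 * (h + kC * T) * (norm x)\<^sup>2" for x
  proof -
    have R: "R \<ge> 0" using P(2) by simp
    have t': "0 \<le> t" using a t by simp
    note oP = P(1)[unfolded sol_def, THEN conjunct1]
    note pair = sol_pairing[OF P(1) R H(1) a order_refl t order_refl, of x x]
    have PT: "P T y = H y" for y
      using sol_eq[OF P(1), of T y] Lam_terminal[of T H y] H(1) t t' by simp
    have form: "re_part \<langle>y, U r t x\<rangle> \<le> k * (M * norm x)\<^sup>2"
      if "norm y \<le> k * norm (U r t x)" "k \<ge> 0" "t \<le> r" "r \<le> T" for y r k
    proof -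
      have "re_part \<langle>y, U r t x\<rangle> \<le> norm y * norm (U r t x)"
        using abs_re_part_le[of "\<langle>y, U r t x\<rangle>"] norm_blinfun[of y "U r t x"] by linarith
      also have "\<dots> \<le> k * norm (U r t x) * norm (U r t x)"
        using that(1) by (rule mult_right_mono) simp
      also have "\<dots> = k * (norm (U r t x))\<^sup>2"
        by (simp add: power2_eq_square)
      also have "\<dots> \<le> k * (M * norm x)\<^sup>2"
        using that t' by (intro mult_left_mono power_mono U_bound) auto
      finally show ?thesis .
    qed
    have "re_part \<langle>P t x, x\<rangle> = re_part \<langle>H (U T t x), U T t x\<rangle>
        + integral {t..T} (\<lambda>q. re_part \<langle>source P q (U q t x), U q t x\<rangle>)"
      using integral_linear[OF pair(2) bounded_linear_re_part]
      by (simp add: pair(1) PT re_part_add o_def)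
    moreover have "re_part \<langle>H (U T t x), U T t x\<rangle> \<le> h * (M * norm x)\<^sup>2"
      by (rule form) (use H t in auto)
    moreover have "integral {t..T} (\<lambda>q. re_part \<langle>source P q (U q t x), U q t x\<rangle>)
        \<le> integral {t..T} (\<lambda>q. kC * (M * norm x)\<^sup>2)"
    proof (rule integral_le)
      show "(\<lambda>q. re_part \<langle>source P q (U q t x), U q t x\<rangle>) integrable_on {t..T}"
        using integrable_linear[OF pair(2) bounded_linear_re_part] by (simp add: o_def)
      show "(\<lambda>q. kC * (M * norm x)\<^sup>2) integrable_on {t..T}"
        by (rule integrable_const_ivl)
      fix q assume q: "q \<in> {t..T}"
      have "re_part \<langle>C q (U q t x), U q t x\<rangle> \<le> kC * (M * norm x)\<^sup>2"
        by (rule form) (use q t' kC_pos C_bound in auto)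
      moreover have "P q (U q t x) \<in> D"
        by (rule opfunD(4)[OF oP]) (use q t in auto)
      then have "re_part \<langle>P q (U q t x), B q (P q (U q t x))\<rangle> \<ge> 0"
        by (intro re_B_nonneg) (use q t' in auto)
      moreover have "selfadjoint_X_dual scl (P q)"
        by (rule sa) (use q t in auto)
      ultimately show "re_part \<langle>source P q (U q t x), U q t x\<rangle> \<le> kC * (M * norm x)\<^sup>2"
        by (simp add: re_source)
    qed
    \<comment> \<open>The length \<open>T - t\<close> is enlarged to \<open>T\<close>, which makes
      the bound independent of \<open>t\<close>.\<close>
    moreover have "integral {t..T} (\<lambda>q. kC * (M * norm x)\<^sup>2) \<le> T * (kC * (M * norm x)\<^sup>2)"
      using t t' kC_pos by (simp add: mult_right_mono)
    ultimately show ?thesis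
      by (simp add: algebra_simps power_mult_distrib)
  qed
qed

lemma global_solution:
  assumes G: "selfadjoint_X_dual scl G" "nonneg_X_dual G"
  obtains P R where "R > 0" "sol 0 T R G P" "\<And>t. 0 \<le> t \<Longrightarrow> t \<le> T \<Longrightarrow> selfadjoint_X_dual scl (P t)"
proof -
  note Gop = selfadjoint_X_dualD(1)[OF G(1)]
  note GD = L_X_dual_simps(1)[OF Gop]
  have G_pos: "re_part \<langle>G x, x\<rangle> \<ge> 0" for x
    using G(2) unfolding nonneg_X_dual_def by (blast intro: re_part_nonneg)
  obtain g where g: "g > 0" "\<And>i x. i \<in> {()} \<Longrightarrow> norm (G x) \<le> g * norm x"
    by (rule uniformly_bounded_L_X_dual[of "{()}" "\<lambda>_. G"]) (use Gop in auto)
  have g': "norm (G x) \<le> g * norm x" for x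
    by (rule g(2)) simp
  \<comment> \<open>The a priori bound for the terminal operator \<open>G\<close>, fixed before the
    interval length \<open>h\<close> is chosen.\<close>
  define \<beta> where "\<beta> = M\<^sup>2 * (g + kC * T)"
  have \<beta>: "\<beta> > 0"
    using M_pos g(1) kC_pos T_nonneg by (simp add: \<beta>_def add_pos_nonneg)
  obtain h R0 where h: "h > 0" and R0: "R0 > 0"
    and local: "\<And>a b H. 0 \<le> a \<Longrightarrow> b \<le> T \<Longrightarrow> b - a \<le> h \<Longrightarrow> selfadjoint_X_dual scl H \<Longrightarrow>
      (\<And>x. norm (H x) \<le> \<beta> * norm x) \<Longrightarrow>
      \<exists>P. sol a b R0 H P \<and> (\<forall>t\<in>{a..b}. selfadjoint_X_dual scl (P t))"
    using local_solution[OF \<beta>] by blast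
  \<comment> \<open>The cut-off at 0 may shorten the last interval. For \<open>n = 0\<close> the
    interval is the single point \<open>T\<close>, where the constant \<open>G\<close> solves the
    equation. The radius may grow with \<open>n\<close>, but the a priori bound does not involve
    it.\<close>
  have "\<exists>P R. R > 0 \<and> sol (max 0 (T - real n * h)) T R G P \<and>
      (\<forall>t. max 0 (T - real n * h) \<le> t \<longrightarrow> t \<le> T \<longrightarrow> selfadjoint_X_dual scl (P t))" for n
  proof (induction n)
    case 0
    have "opfun T T g (\<lambda>_. G)"
      using Gop g' by (auto simp: opfun_def)
    then have "sol T T g G (\<lambda>_. G)"
      using Lam_terminal[of T G] T_nonneg GD by (auto simp: sol_def)
    then show ?case
      using g(1) G(1) T_nonneg by (intro exI[of _ "\<lambda>_. G"] exI[of _ g]) simp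
  next
    case (Suc n)
    define a a' where "a = max 0 (T - real n * h)" and "a' = max 0 (T - real (Suc n) * h)"
    have a: "0 \<le> a'" "a' \<le> a" "a \<le> T" "a - a' \<le> h" "0 \<le> a"
      using T_nonneg h by (auto simp: a_def a'_def max_def algebra_simps)
    obtain P R where P: "R > 0" "sol a T R G P"
      and sa: "\<And>t. a \<le> t \<Longrightarrow> t \<le> T \<Longrightarrow> selfadjoint_X_dual scl (P t)"
      using Suc.IH unfolding a_def by blast
    \<comment> \<open>The bound is computed from \<open>G\<close> at time \<open>T\<close>, not from
      the preceding interval, so it does not grow with \<open>n\<close> and the same
      \<open>h\<close> works again.\<close>
    have "norm (P a x) \<le> \<beta> * norm x" for x
      unfolding \<beta>_def using g(1)
      by (intro sol_a_priori_bound[OF P(2,1) sa GD G_pos g' _ a(5) order_refl a(3)]) auto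
    then obtain P' where P': "sol a' a R0 (P a) P'"
      and sa': "\<And>t. a' \<le> t \<Longrightarrow> t \<le> a \<Longrightarrow> selfadjoint_X_dual scl (P' t)"
      using local[OF a(1,3,4) sa[OF order_refl a(3)]] by auto
    have "sol a' T (max R R0) G (\<lambda>t. if t \<le> a then P' t else P t)"
      by (rule sol_glue[OF P(2) P']) (use P(1) R0 GD a in auto)
    moreover have "selfadjoint_X_dual scl (if t \<le> a then P' t else P t)" if "a' \<le> t" "t \<le> T" for t
      using sa[of t] sa'[of t] that by auto
    moreover have "max R R0 > 0"
      using R0 by simp
    ultimately show ?case
      unfolding a'_def[symmetric] by blast
  qed
  moreover obtain n where "T < real n * h"
    using reals_Archimedean3[OF h] by blast
  then have "max 0 (T - real n * h) = 0" by simp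
  ultimately show thesis
    using that by metis
qed

end

theorem theorem2:
  fixes scl :: "'k::real_or_complex \<Rightarrow> 'a::banach \<Rightarrow> 'a"
    and T :: real
    and U :: "real \<Rightarrow> real \<Rightarrow> 'a \<Rightarrow> 'a"
    and V :: "real \<Rightarrow> real \<Rightarrow> ('a \<Rightarrow>\<^sub>L 'k) \<Rightarrow> ('a \<Rightarrow>\<^sub>L 'k)"
    and C :: "real \<Rightarrow> 'a \<Rightarrow> ('a \<Rightarrow>\<^sub>L 'k)"
    and B :: "real \<Rightarrow> ('a \<Rightarrow>\<^sub>L 'k) \<Rightarrow> 'a"
    and G :: "'a \<Rightarrow> ('a \<Rightarrow>\<^sub>L 'k)"
  assumes "banach_over scl" and "reflexive_space scl" and "T > 0"
    and "forward_evolution_family scl T U"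
    and "forward_strongly_continuous T U"
    and "forward_uniformly_bounded T U"
    and "\<And>t s. 0 \<le> t \<Longrightarrow> t \<le> s \<Longrightarrow> s \<le> T \<Longrightarrow> is_adjoint_X_X scl (U s t) (V t s)"
    and "backward_strongly_continuous scl T V"
    and "C \<in> Cs_X_dual scl T" and "B \<in> Cs_dual_X scl T"
    and "\<And>t. t \<in> {0..T} \<Longrightarrow> selfadjoint_X_dual scl (C t) \<and> nonneg_X_dual (C t)"
    and "\<And>t. t \<in> {0..T} \<Longrightarrow> selfadjoint_dual_X scl (B t) \<and> nonneg_dual_X scl (B t)"
    and "G \<in> L_X_dual scl" and "selfadjoint_X_dual scl G" and "nonneg_X_dual G"
  shows "\<exists>P \<in> Cs_X_dual scl T.
      riccati_solution T U V C B G P \<and>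
      (\<forall>t\<in>{0..T}. selfadjoint_X_dual scl (P t) \<and> nonneg_X_dual (P t)) \<and>
      (\<forall>Q \<in> Cs_X_dual scl T. riccati_solution T U V C B G Q \<longrightarrow> (\<forall>t\<in>{0..T}. Q t = P t))"
proof -
  interpret X: banach_over scl by fact
  have U: "U t s \<in> L_X_X scl" if "0 \<le> s" "s \<le> t" "t \<le> T" for s t
    using assms(4) that unfolding forward_evolution_family_def by blast
  obtain M0 where M0: "\<And>s t. 0 \<le> s \<Longrightarrow> s \<le> t \<Longrightarrow> t \<le> T \<Longrightarrow> onorm (U t s) \<le> M0"
    using assms(6) unfolding forward_uniformly_bounded_def by blast
  \<comment> \<open>The maximum with 1 makes the constant positive.\<close>
  define M where "M = max M0 1"
  have U_bound: "norm (U t s x) \<le> M * norm x" if "0 \<le> s" "s \<le> t" "t \<le> T" for s t x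
  proof -
    have "norm (U t s x) \<le> onorm (U t s) * norm x"
      by (rule onorm[OF X.L_X_X_bounded_linear[OF U[OF that]]])
    also have "\<dots> \<le> M * norm x"
      using M0[OF that] by (intro mult_right_mono) (auto simp: M_def)
    finally show ?thesis .
  qed
  have C: "C t \<in> L_X_dual scl" if "t \<in> {0..T}" for t
    using assms(9) that by (auto simp: Cs_X_dual_def)
  have C_cont: "continuous_on {0..T} (\<lambda>t. C t x)" for x
    using assms(9) by (simp add: Cs_X_dual_def)
  obtain kC where kC: "kC > 0" "\<And>t x. t \<in> {0..T} \<Longrightarrow> norm (C t x) \<le> kC * norm x"
    using X.uniformly_bounded_L_X_dual[of "{0..T}" C, OF C
        compact_imp_bounded[OF compact_continuous_image[OF C_cont compact_Icc]]] by blast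
  have B: "B t \<in> L_dual_X scl" if "t \<in> {0..T}" for t
    using assms(10) that by (auto simp: Cs_dual_X_def)
  have B_cont: "continuous_on {0..T} (\<lambda>t. B t y)" if "y \<in> dual scl" for y
    using assms(10) that by (simp add: Cs_dual_X_def)
  obtain kB where kB: "kB > 0" "\<And>t y. t \<in> {0..T} \<Longrightarrow> y \<in> dual scl \<Longrightarrow> norm (B t y) \<le> kB * norm y"
    using X.uniformly_bounded_L_dual_X[of "{0..T}" B, OF B
        compact_imp_bounded[OF compact_continuous_image[OF B_cont compact_Icc]]] by blast
  interpret riccati_data scl T U V C B M kC kB
  proof (intro riccati_data.intro riccati_data_axioms.intro)
    show "banach_over scl" by fact
    show "U t r (U r s x) = U t s x" if "0 \<le> s" "s \<le> r" "r \<le> t" "t \<le> T" for s r t x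
      using assms(4) that unfolding forward_evolution_family_def by (metis comp_apply)
    show "U s s x = x" if "0 \<le> s" "s \<le> T" for s x
      using assms(4) that unfolding forward_evolution_family_def by (metis atLeastAtMost_iff id_apply)
    show "continuous_on {s..T} (\<lambda>t. U t s x)" if "0 \<le> s" "s \<le> T" for s x
      using assms(5) that unfolding forward_strongly_continuous_def by simp
    show "continuous_on {0..t} (\<lambda>s. U t s x)" if "0 \<le> t" "t \<le> T" for t x
      using assms(5) that unfolding forward_strongly_continuous_def by simp
    show "continuous_on {0..s} (\<lambda>t. V t s y)" if "y \<in> dual scl" "0 \<le> s" "s \<le> T" for s y
      using assms(8) that unfolding backward_strongly_continuous_def by simp
    show "continuous_on {t..T} (\<lambda>s. V t s y)" if "y \<in> dual scl" "0 \<le> t" "t \<le> T" for t y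
      using assms(8) that unfolding backward_strongly_continuous_def by simp
    show "M > 0" by (simp add: M_def)
    show "T \<ge> 0" using assms(3) by simp
  qed (use U U_bound C C_cont kC B B_cont kB assms(7,11,12) in auto)
  obtain P R where P: "R > 0" "sol 0 T R G P"
    and sa: "\<And>t. 0 \<le> t \<Longrightarrow> t \<le> T \<Longrightarrow> selfadjoint_X_dual scl (P t)"
    using global_solution[OF assms(14,15)] by blast
  note oP = P(2)[unfolded sol_def, THEN conjunct1]
  have R: "R \<ge> 0" using P(1) by simp
  have GD: "G x \<in> dual scl" for x
    by (rule X.L_X_dual_simps(1)[OF assms(13)])
  have G_pos: "re_part \<langle>G x, x\<rangle> \<ge> 0" for x
    using assms(15) unfolding nonneg_X_dual_def by (blast intro: re_part_nonneg)
  show ?thesis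
  proof (intro bexI conjI ballI impI)
    show "P \<in> Cs_X_dual scl T" by (rule opfun_Cs_X_dual[OF oP])
    show "riccati_solution T U V C B G P"
      using P(2) riccati_solution_iff_sol[OF oP R] by blast
    fix t assume t: "t \<in> {0..T}"
    then have t': "0 \<le> t" "t \<le> T" by auto
    show "selfadjoint_X_dual scl (P t)" by (rule sa[OF t'])
    show "nonneg_X_dual (P t)"
      unfolding nonneg_X_dual_def
    proof
      fix x
      \<comment> \<open>Self-adjointness makes the value real, so the sign of its real part
        decides.\<close>
      have "conj \<langle>P t x, x\<rangle> = \<langle>P t x, x\<rangle>"
        using selfadjoint_X_dualD(2)[OF sa[OF t'], of x x] by (rule sym)
      then have "\<langle>P t x, x\<rangle> = of_real (re_part \<langle>P t x, x\<rangle>)"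
        using of_real_re_part by metis
      moreover have "re_part \<langle>P t x, x\<rangle> \<ge> 0"
        by (rule sol_nonneg[OF P(2,1) sa GD G_pos order_refl order_refl t'])
      ultimately show "\<langle>P t x, x\<rangle> \<in> \<real>\<^sub>\<ge>\<^sub>0"
        by (metis nonneg_Reals_of_real_iff)
    qed
  next
    fix Q t assume Q: "Q \<in> Cs_X_dual scl T" "riccati_solution T U V C B G Q" and "t \<in> {0..T}"
    then have t: "0 \<le> t" "t \<le> T" by auto
    obtain R' where "R' > 0" "opfun 0 T R' Q"
      by (rule Cs_X_dual_opfun[OF Q(1)])
    \<comment> \<open>\<open>P\<close> and \<open>Q\<close> come with different radii; uniqueness
      compares them in a common ball.\<close>
    define R'' where "R'' = max R R'"
    have R'': "R'' > 0" "R'' \<ge> 0" using P(1) by (auto simp: R''_def)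
    have o: "opfun 0 T R'' P" "opfun 0 T R'' Q"
      using oP \<open>opfun 0 T R' Q\<close> by (auto intro: opfun_mono simp: R''_def)
    have "sol 0 T R'' G P"
      using P(2) o(1) by (simp add: sol_def)
    moreover have "sol 0 T R'' G Q"
      using Q(2) riccati_solution_iff_sol[OF o(2) R''(2)] by blast
    ultimately show "Q t = P t"
      using sol_unique[OF _ _ R''(1) order_refl order_refl t] by blast
  qed
qed

end
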